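(* Let $X_1,X_2,\dots$ be i.i.d. $\mathcal N(\mu_0,\sigma_0^2)$ with $\sigma_0^2>0$, and let the eavesdropper have causal general awareness, i.e. side information $s^E_i=\{x^{i-1},y^{i-1},z^{i-1}\}$ at time $i$. Let $R\ge 0$ and let the key rate satisfy $R_s\ge 1$ bit per source symbol. Then the optimal secrecy rate-payoff function is $$\Pi(R,R_s)=1-2^{-2R}.$$
   Context: Setting. Alice observes an i.i.d. source sequence $X^n$, $X_i\sim p_0=\mathcal N(\mu_0,\sigma_0^2)$. Alice and Bob share a secret key $K$ uniform on $\{1,\dots,2^{nR_s}\}$, independent of $X^n$. A (possibly stochastic) encoder $f_n$, i.e. a kernel $p(m|x^n,k)$, produces a message $M\in\{1,\dots,2^{nR}\}$, sent noiselessly and seen by both Bob and Eve. Bob uses (possibly stochastic) decoders $g_i$, i.e. kernels $p(y_i|m,s^B_i)$, to produce real-valued $Y_i$, $i=1,\dots,n$, with side information $s^B_i=\{k,x^{i-1},y^{i-1},z^{i-1}\}$ (it is known from earlier work that restricting to $s^B_i=\{k\}$ loses nothing). Eve uses (possibly stochastic) decoders $t_i$, i.e. kernels $p(z_i|m,s^E_i)$, to produce real-valued $Z_i$, where $s^E_i$ is her side information at time $i$; here $x^{i-1}=(x_1,\dots,x_{i-1})$ and similarly for $y^{i-1},z^{i-1}$. Rates are in bits (base-2 logarithms). Payoff: $\pi(x,y,z)=\frac{1}{\sigma_0^2}[(z-x)^2-(y-x)^2]$ and $\pi(x^n,y^n,z^n)=\frac1n\sum_{i=1}^n\pi(x_i,y_i,z_i)$.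 Achievability: $(R,R_s,\Pi)$ is achievable if $$\lim_{n\to\infty}\ \sup_{f_n,\{g_i\}_{i=1}^n}\ \inf_{\{t_i\}_{i=1}^n}\ \mathbb E\,\pi(X^n,Y^n,Z^n)\ \ge\ \Pi .$$ $\Pi(R,R_s)$ is the maximum $\Pi$ such that $(R,R_s,\Pi)$ is achievable. For causal general awareness, the following characterization of this quantity from earlier literature is taken as given: $$\Pi(R,R_s)=\max_{p(y,u,v|x)\in\mathcal P}\ \min_{z(\cdot)}\ \mathbb E\,\pi(X,Y,z(U)),$$ $$\mathcal P=\{p(y,u,v|x):\ p(y|u,v,x)=p(y|u,v),\ R_s\ge I(X,Y;V|U),\ R\ge I(X;U,V)\},$$ where $X\sim p_0$, $U,V$ are auxiliary random variables, and the minimum is over functions $z$ of $u$. *)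

theory Defs
  imports "HOL-Probability.Probability"
begin

definition gaussian :: "real \<Rightarrow> real \<Rightarrow> real measure" where
  "gaussian \<mu> \<sigma> = density lborel (normal_density \<mu> \<sigma>)"

definition payoff :: "real \<Rightarrow> real \<Rightarrow> real \<Rightarrow> real \<Rightarrow> real" where
  "payoff \<sigma> x y z = ((z - x)\<^sup>2 - (y - x)\<^sup>2) / \<sigma>\<^sup>2"

definition block_payoff ::
  "real \<Rightarrow> nat \<Rightarrow> (nat \<Rightarrow> real) \<Rightarrow> (nat \<Rightarrow> real) \<Rightarrow> (nat \<Rightarrow> real) \<Rightarrow> real" where
  "block_payoff \<sigma> n x y z = (\<Sum>i<n. payoff \<sigma> (x i) (y i) (z i)) / real n"

text \<open>Positive part minus negative part, because payoffs need not be integrable.  How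
  \<open>\<infinity> - \<infinity>\<close> is read is immaterial for the infima taken below: if Bob's distortion is infinite,
  a constant guess of Eve already yields \<open>-\<infinity>\<close>; if it is finite, the negative part
  is always integrable.\<close>

definition ext_expectation :: "'a measure \<Rightarrow> ('a \<Rightarrow> real) \<Rightarrow> ereal" where
  "ext_expectation M f =
     enn2ereal (\<integral>\<^sup>+\<omega>. ennreal (f \<omega>) \<partial>M) - enn2ereal (\<integral>\<^sup>+\<omega>. ennreal (- f \<omega>) \<partial>M)"


section \<open>Codes and the operational secrecy rate-payoff function\<close>

text \<open>Time runs through \<open>0, \<dots>, n - 1\<close>; the past at time \<open>i\<close> is a function on \<open>{..<i}\<close>.\<close>

type_synonym rseq = "nat \<Rightarrow> real"

definition seq_space :: "nat \<Rightarrow> rseq measure" where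
  "seq_space n = (\<Pi>\<^sub>M i\<in>{..<n}. borel)"

definition source :: "real \<Rightarrow> real \<Rightarrow> nat \<Rightarrow> rseq measure" where
  "source \<mu> \<sigma> n = (\<Pi>\<^sub>M i\<in>{..<n}. gaussian \<mu> \<sigma>)"

text \<open>The index set \<open>{1, \<dots>, 2^(n r)}\<close>, rounded down when \<open>2^(n r)\<close> is not an integer.\<close>

definition index_set :: "nat \<Rightarrow> real \<Rightarrow> nat set" where
  "index_set n r = {1..nat \<lfloor>2 powr (real n * r)\<rfloor>}"

text \<open>Stochastic encoders and decoders are Markov kernels.  Bob sees \<open>(m, (k, x, y, z))\<close>
  with the pasts of \<open>x\<close>, \<open>y\<close>, \<open>z\<close>; Eve sees \<open>(m, (x, y, z))\<close>, which is
  causal general awareness.\<close>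

type_synonym encoder = "rseq \<times> nat \<Rightarrow> nat measure"
type_synonym bob_decoder = "nat \<times> nat \<times> rseq \<times> rseq \<times> rseq \<Rightarrow> real measure"
type_synonym eve_decoder = "nat \<times> rseq \<times> rseq \<times> rseq \<Rightarrow> real measure"

definition encoders :: "real \<Rightarrow> real \<Rightarrow> nat \<Rightarrow> encoder set" where
  "encoders R Rs n =
     seq_space n \<Otimes>\<^sub>M count_space (index_set n Rs) \<rightarrow>\<^sub>M prob_algebra (count_space (index_set n R))"

definition past_space :: "nat \<Rightarrow> (rseq \<times> rseq \<times> rseq) measure" where
  "past_space i = seq_space i \<Otimes>\<^sub>M seq_space i \<Otimes>\<^sub>M seq_space i"

definition bob_decoders :: "real \<Rightarrow> real \<Rightarrow> nat \<Rightarrow> (nat \<Rightarrow> bob_decoder) set" where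
  "bob_decoders R Rs n = {g. \<forall>i<n. g i \<in>
     count_space (index_set n R) \<Otimes>\<^sub>M count_space (index_set n Rs) \<Otimes>\<^sub>M past_space i
       \<rightarrow>\<^sub>M prob_algebra borel}"

definition eve_decoders :: "real \<Rightarrow> nat \<Rightarrow> (nat \<Rightarrow> eve_decoder) set" where
  "eve_decoders R n = {t. \<forall>i<n. t i \<in>
     count_space (index_set n R) \<Otimes>\<^sub>M past_space i \<rightarrow>\<^sub>M prob_algebra borel}"

definition state_space ::
  "real \<Rightarrow> real \<Rightarrow> nat \<Rightarrow> nat \<Rightarrow> (rseq \<times> nat \<times> nat \<times> rseq \<times> rseq) measure" where
  "state_space R Rs n i =
     seq_space n \<Otimes>\<^sub>M count_space (index_set n Rs) \<Otimes>\<^sub>M count_space (index_set n R)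
       \<Otimes>\<^sub>M seq_space i \<Otimes>\<^sub>M seq_space i"

text \<open>Joint law of \<open>(X\<^sup>n, K, M, Y\<^sup>i, Z\<^sup>i)\<close>.  At each time \<open>Y\<^sub>i\<close> and \<open>Z\<^sub>i\<close> are drawn with
  independent local randomness.\<close>

primrec transcript ::
  "real \<Rightarrow> real \<Rightarrow> real \<Rightarrow> real \<Rightarrow> nat \<Rightarrow> encoder \<Rightarrow> (nat \<Rightarrow> bob_decoder) \<Rightarrow> (nat \<Rightarrow> eve_decoder)
     \<Rightarrow> nat \<Rightarrow> (rseq \<times> nat \<times> nat \<times> rseq \<times> rseq) measure" where
  "transcript \<mu> \<sigma> R Rs n f g t 0 =
     (source \<mu> \<sigma> n \<Otimes>\<^sub>M uniform_count_measure (index_set n Rs)) \<bind> (\<lambda>(x, k).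
      f (x, k) \<bind> (\<lambda>m.
      return (state_space R Rs n 0) (x, k, m, (\<lambda>_. undefined), (\<lambda>_. undefined))))"
| "transcript \<mu> \<sigma> R Rs n f g t (Suc i) =
     transcript \<mu> \<sigma> R Rs n f g t i \<bind> (\<lambda>(x, k, m, y, z).
      g i (m, k, restrict x {..<i}, y, z) \<bind> (\<lambda>y'.
      t i (m, restrict x {..<i}, y, z) \<bind> (\<lambda>z'.
      return (state_space R Rs n (Suc i)) (x, k, m, y(i := y'), z(i := z')))))"

definition expected_payoff ::
  "real \<Rightarrow> real \<Rightarrow> real \<Rightarrow> real \<Rightarrow> nat \<Rightarrow> encoder \<Rightarrow> (nat \<Rightarrow> bob_decoder) \<Rightarrow> (nat \<Rightarrow> eve_decoder)
     \<Rightarrow> ereal" where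
  "expected_payoff \<mu> \<sigma> R Rs n f g t =
     ext_expectation (transcript \<mu> \<sigma> R Rs n f g t n)
       (\<lambda>(x, k, m, y, z). block_payoff \<sigma> n x y z)"

definition game_value :: "real \<Rightarrow> real \<Rightarrow> real \<Rightarrow> real \<Rightarrow> nat \<Rightarrow> ereal" where
  "game_value \<mu> \<sigma> R Rs n =
     (SUP (f, g) \<in> encoders R Rs n \<times> bob_decoders R Rs n.
        INF t \<in> eve_decoders R n. expected_payoff \<mu> \<sigma> R Rs n f g t)"

definition achievable :: "real \<Rightarrow> real \<Rightarrow> real \<Rightarrow> real \<Rightarrow> real \<Rightarrow> bool" where
  "achievable \<mu> \<sigma> R Rs v \<longleftrightarrow> (\<exists>L. game_value \<mu> \<sigma> R Rs \<longlonglongrightarrow> L \<and> ereal v \<le> L)"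

text \<open>\<open>is_secrecy_rate_payoff \<mu> \<sigma> R Rs v\<close> says that the maximum \<open>\<Pi>(R, R\<^sub>s)\<close>
  exists and equals \<open>v\<close>.\<close>

definition is_secrecy_rate_payoff :: "real \<Rightarrow> real \<Rightarrow> real \<Rightarrow> real \<Rightarrow> real \<Rightarrow> bool" where
  "is_secrecy_rate_payoff \<mu> \<sigma> R Rs v \<longleftrightarrow>
     achievable \<mu> \<sigma> R Rs v \<and> (\<forall>v'. achievable \<mu> \<sigma> R Rs v' \<longrightarrow> v' \<le> v)"


section \<open>Information measures with values in \<open>[0, \<infinity>]\<close>\<close>

text \<open>The library's \<open>KL_divergence\<close> and \<open>mutual_information\<close> are real-valued and return
  arbitrary values where the divergence is infinite; there the value has to be \<open>\<infinity>\<close>.  The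
  negative part of the log-likelihood ratio is always integrable, so a non-integrable
  one means an infinite divergence.\<close>

definition rel_entropy :: "'a measure \<Rightarrow> 'a measure \<Rightarrow> ennreal" where
  "rel_entropy P Q =
     (if absolutely_continuous Q P \<and> integrable P (entropy_density 2 Q P)
      then ennreal (KL_divergence 2 Q P) else \<infinity>)"

definition mutual_info ::
  "'w measure \<Rightarrow> 'a measure \<Rightarrow> 'b measure \<Rightarrow> ('w \<Rightarrow> 'a) \<Rightarrow> ('w \<Rightarrow> 'b) \<Rightarrow> ennreal" where
  "mutual_info P S T A B =
     rel_entropy (distr P (S \<Otimes>\<^sub>M T) (\<lambda>\<omega>. (A \<omega>, B \<omega>))) (distr P S A \<Otimes>\<^sub>M distr P T B)"

definition regular_cond_law ::
  "'w measure \<Rightarrow> 'a measure \<Rightarrow> 'c measure \<Rightarrow> ('w \<Rightarrow> 'a) \<Rightarrow> ('w \<Rightarrow> 'c) \<Rightarrow> ('c \<Rightarrow> 'a measure) \<Rightarrow> bool"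
where
  "regular_cond_law P S T A C \<kappa> \<longleftrightarrow>
     \<kappa> \<in> T \<rightarrow>\<^sub>M prob_algebra S \<and>
     distr P (T \<Otimes>\<^sub>M S) (\<lambda>\<omega>. (C \<omega>, A \<omega>)) =
       distr P T C \<bind> (\<lambda>c. \<kappa> c \<bind> (\<lambda>a. return (T \<Otimes>\<^sub>M S) (c, a)))"

text \<open>\<open>I(A; B | C)\<close> as the average over \<open>c\<close> of the mutual information of \<open>A\<close> and \<open>B\<close>
  under their conditional law given \<open>C = c\<close>.  Only standard Borel spaces are used below, so
  a regular conditional law exists and is unique up to null sets.  (The library's
  \<open>conditional_mutual_information\<close>, a difference of two mutual informations, is
  meaningless when both are infinite, which happens for continuous auxiliaries.)\<close>

definition cond_mutual_info ::
  "'w measure \<Rightarrow> 'a measure \<Rightarrow> 'b measure \<Rightarrow> 'c measure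
     \<Rightarrow> ('w \<Rightarrow> 'a) \<Rightarrow> ('w \<Rightarrow> 'b) \<Rightarrow> ('w \<Rightarrow> 'c) \<Rightarrow> ennreal" where
  "cond_mutual_info P S T W A B C =
     (let \<kappa> = (SOME \<kappa>. regular_cond_law P (S \<Otimes>\<^sub>M T) W (\<lambda>\<omega>. (A \<omega>, B \<omega>)) C \<kappa>)
      in \<integral>\<^sup>+c. mutual_info (\<kappa> c) S T fst snd \<partial>distr P W C)"


section \<open>The single-letter expression\<close>

text \<open>A kernel \<open>p(y,u,v|x)\<close> maps \<open>x\<close> to a law of \<open>(y, u, v)\<close>.  The auxiliaries \<open>U\<close>, \<open>V\<close> are
  real-valued, which up to Borel isomorphism covers all standard Borel alphabets.\<close>

type_synonym test_channel = "real \<Rightarrow> (real \<times> real \<times> real) measure"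

definition joint_law :: "real \<Rightarrow> real \<Rightarrow> test_channel \<Rightarrow> (real \<times> real \<times> real \<times> real) measure" where
  "joint_law \<mu> \<sigma> p =
     gaussian \<mu> \<sigma> \<bind> (\<lambda>x. p x \<bind> (\<lambda>(y, u, v).
       return (borel \<Otimes>\<^sub>M borel \<Otimes>\<^sub>M borel \<Otimes>\<^sub>M borel) (x, y, u, v)))"

definition admissible :: "real \<Rightarrow> real \<Rightarrow> real \<Rightarrow> real \<Rightarrow> test_channel set" where
  "admissible \<mu> \<sigma> R Rs =
     {p \<in> borel \<rightarrow>\<^sub>M prob_algebra (borel \<Otimes>\<^sub>M borel \<Otimes>\<^sub>M borel).
        let J = joint_law \<mu> \<sigma> p;
            X = (\<lambda>(x, y, u, v). x); Y = (\<lambda>(x, y, u, v). y);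
            U = (\<lambda>(x, y, u, v). u); V = (\<lambda>(x, y, u, v). v)
        in (\<exists>q. regular_cond_law J borel (borel \<Otimes>\<^sub>M borel \<Otimes>\<^sub>M borel)
                  Y (\<lambda>\<omega>. (U \<omega>, V \<omega>, X \<omega>)) (\<lambda>(u, v, x). q (u, v)) \<and>
                regular_cond_law J borel (borel \<Otimes>\<^sub>M borel) Y (\<lambda>\<omega>. (U \<omega>, V \<omega>)) q) \<and>
           ennreal Rs \<ge> cond_mutual_info J (borel \<Otimes>\<^sub>M borel) borel borel
                  (\<lambda>\<omega>. (X \<omega>, Y \<omega>)) V U \<and>
           ennreal R \<ge> mutual_info J borel (borel \<Otimes>\<^sub>M borel) X (\<lambda>\<omega>. (U \<omega>, V \<omega>))}"

text \<open>The infimum over \<open>z\<close> is a minimum: it is attained by the conditional mean of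
  \<open>X\<close> given \<open>U\<close> if Bob's distortion is finite, and by a constant otherwise.\<close>

definition single_letter_value :: "real \<Rightarrow> real \<Rightarrow> test_channel \<Rightarrow> ereal" where
  "single_letter_value \<mu> \<sigma> p =
     (INF z \<in> borel \<rightarrow>\<^sub>M borel.
        ext_expectation (joint_law \<mu> \<sigma> p) (\<lambda>(x, y, u, v). payoff \<sigma> x y (z u)))"

definition is_single_letter_max :: "real \<Rightarrow> real \<Rightarrow> real \<Rightarrow> real \<Rightarrow> real \<Rightarrow> bool" where
  "is_single_letter_max \<mu> \<sigma> R Rs v \<longleftrightarrow>
     (\<exists>p\<in>admissible \<mu> \<sigma> R Rs. single_letter_value \<mu> \<sigma> p = ereal v) \<and>
     (\<forall>p\<in>admissible \<mu> \<sigma> R Rs. single_letter_value \<mu> \<sigma> p \<le> ereal v)"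

end

theory Submission
  imports Defs
begin

text \<open>By the characterization it suffices to maximise the single-letter expression.

  Upper bound: let Eve always guess \<open>\<mu>\<close>, so that the payoff is \<open>1 - E (Y - X)\<^sup>2 / \<sigma>\<^sup>2\<close> and the claim
  is the Gaussian rate-distortion bound.  With \<open>\<tau> = \<sigma> 2 powr (- R)\<close>, \<open>N\<close> the law of \<open>(X, (U, V))\<close>
  and \<open>Q\<close> the product of its marginals, integrate \<open>ln t \<le> t - 1\<close> at the quotient of the
  likelihood ratio of \<open>\<N>(Y, \<tau>\<^sup>2)\<close> to \<open>\<N>(\<mu>, \<sigma>\<^sup>2)\<close> at \<open>X\<close> by \<open>dN/dQ\<close>.

  Attainment: let \<open>Y\<close> be the output of the optimal Gaussian test channel, so that \<open>X\<close> given \<open>Y\<close> is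
  \<open>\<N>(Y, \<tau>\<^sup>2)\<close>, and put \<open>U = \<bar>Y - \<mu>\<bar>\<close>, \<open>V = Y\<close>.  Given \<open>U\<close>, only the sign of \<open>Y - \<mu>\<close> is
  unknown, which costs at most one bit of key; and by the symmetry about \<open>\<mu>\<close>, \<open>U\<close> does not help
  Eve to estimate \<open>X\<close>.\<close>

section \<open>Relative entropy and mutual information\<close>

text \<open>The value \<open>1 - 2 powr (- 2 * R)\<close> asks for two things at once: Bob at the
  rate-distortion limit, and Eve no better than the constant guess \<mu>. With U constant and V = Y
  the second is clear, but for R > 0 the output Y is continuous and I(X,Y;V|U) is infinite, beyond
  any key. So Y is disclosed up to a finite ambiguity, in such a way that the conditional mean of X
  stays at \<mu>. The modulus does this and hides just a fair sign: this is where the one bit of key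
  comes from.

  The auxiliaries in the upper bound are arbitrary, so no densities or differential entropies are at
  hand. The bound therefore works with dN/dQ itself, testing it against one function whose
  exponential has mean 1 under the source law for every value of Y. For the optimal channel this
  function is exactly the log-likelihood ratio of N to Q, which is why the bound is tight. Since
  \<open>rel_entropy\<close> is finite only if the log-likelihood ratio is integrable, integrability
  is shown along with each value.\<close>

lemma rel_entropy_le_log_second_moment:
  assumes "prob_space N" "prob_space Q" and ac: "absolutely_continuous Q N"
    and sets: "sets N = sets Q"
    and C: "C > 0" and le: "(\<integral>\<^sup>+x. RN_deriv Q N x \<partial>N) \<le> ennreal C"
  shows "rel_entropy N Q \<le> ennreal (log 2 C)"
proof -
  interpret N: prob_space N by fact
  interpret Q: prob_space Q by fact
  obtain D where D[measurable]: "D \<in> borel_measurable Q"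
    and RN: "AE x in Q. RN_deriv Q N x = ennreal (D x)"
    and pos: "AE x in N. 0 < D x" and nn: "\<And>x. 0 \<le> D x"
    using Q.real_RN_deriv[OF _ ac sets] N.finite_measure_axioms by metis
  have meas: "borel_measurable N = borel_measurable Q"
    by (rule measurable_cong_sets[OF sets refl])
  have DN[measurable]: "D \<in> borel_measurable N" by (simp add: meas)
  have RN_N: "AE x in N. RN_deriv Q N x = ennreal (D x)"
    using absolutely_continuous_AE[OF sets ac RN] .
  have N_eq: "N = density Q D"
    using Q.density_RN_deriv[OF ac sets] density_cong[OF _ _ RN] by (metis D borel_measurable_RN_deriv measurable_compose measurable_ennreal)
  have int_D: "(\<integral>\<^sup>+x. ennreal (D x) \<partial>N) \<le> ennreal C"
    using le nn_integral_cong_AE[OF RN_N] by simp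
  \<comment> \<open>The left side is the Q-mass of D > 0, as 1 / 0 = 0. Together with the bound on
    the mean of D this makes ln D integrable, without which \<open>rel_entropy\<close> would be
    infinite by definition.\<close>
  have "(\<integral>\<^sup>+x. ennreal (1 / D x) \<partial>N) = (\<integral>\<^sup>+x. ennreal (D x) * ennreal (1 / D x) \<partial>Q)"
    unfolding N_eq by (subst nn_integral_density) auto
  also have "\<dots> \<le> (\<integral>\<^sup>+x. 1 \<partial>Q)"
    by (intro nn_integral_mono) (auto simp: ennreal_mult'[symmetric] nn)
  finally have int_inv: "(\<integral>\<^sup>+x. ennreal (1 / D x) \<partial>N) \<le> 1" by (simp add: Q.emeasure_space_1)
  have iD: "integrable N D"
    using int_D nn by (intro integrableI_nonneg) (auto simp: order_le_less_trans)
  have iI: "integrable N (\<lambda>x. 1 / D x)"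
    using int_inv nn by (intro integrableI_nonneg) (auto simp: order_le_less_trans)
  have abs_ln: "\<bar>ln t\<bar> \<le> t + 1 / t" if "t > 0" for t :: real
    using ln_le_minus_one[of t] ln_le_minus_one[of "1 / t"] that
    by (auto simp: ln_div abs_if) (smt (verit) divide_pos_pos)+
  have iln: "integrable N (\<lambda>x. ln (D x))"
  proof (rule Bochner_Integration.integrable_bound)
    show "integrable N (\<lambda>x. D x + 1 / D x)" using iD iI by auto
    show "AE x in N. norm (ln (D x)) \<le> norm (D x + 1 / D x)"
      using pos by eventually_elim (use abs_ln in force)
  qed auto
  have ed: "AE x in N. ln (D x) / ln 2 = entropy_density 2 Q N x"
    using RN_N by eventually_elim (auto simp: entropy_density_def log_def nn)
  have edm[measurable]: "entropy_density 2 Q N \<in> borel_measurable N"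
    unfolding meas by measurable
  have ied: "integrable N (entropy_density 2 Q N)"
    by (rule integrable_cong_AE_imp[OF _ _ ed]) (use iln in auto)
  have "KL_divergence 2 Q N = (\<integral>x. ln (D x) / ln 2 \<partial>N)"
    unfolding KL_divergence_def
    by (rule integral_cong_AE) (use ed in \<open>auto elim: eventually_mono\<close>)
  moreover have "(\<integral>x. ln (D x) \<partial>N) \<le> ln C"
  proof -
    \<comment> \<open>Jensen's inequality for ln, by its tangent at C: the mean of D under N is at
      most C, so the linear terms contribute at most 0.\<close>
    have "(\<integral>x. ln (D x) \<partial>N) \<le> (\<integral>x. D x / C - 1 + ln C \<partial>N)"
    proof (rule integral_mono_AE)
      show "AE x in N. ln (D x) \<le> D x / C - 1 + ln C"
        using pos
      proof eventually_elim
        case (elim x)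
        then show ?case using ln_le_minus_one[of "D x / C"] C by (simp add: ln_div)
      qed
    qed (use iln iD in auto)
    also have "\<dots> = (\<integral>x. D x \<partial>N) / C - 1 + ln C"
      using iD by (simp add: N.prob_space)
    also have "(\<integral>x. D x \<partial>N) \<le> C"
      using int_D C nn by (subst integral_eq_nn_integral) (auto intro: enn2real_leI)
    then have "(\<integral>x. D x \<partial>N) / C - 1 + ln C \<le> ln C" using C by simp
    finally show ?thesis .
  qed
  ultimately have "KL_divergence 2 Q N \<le> log 2 C"
    by (simp add: log_def divide_right_mono)
  then show ?thesis
    unfolding rel_entropy_def using ac ied by (auto intro: ennreal_leI)
qed

text \<open>A variant of the Donsker-Varadhan lower bound on relative entropy, from
  \<open>ln t \<le> t - 1\<close> at t = exp \<phi> / (dN/dQ). The function \<phi> lives on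
  \<open>J\<close> and not on the range of \<open>T\<close>, because Bob's Y may carry randomness
  beyond (X, (U, V)). Hence the usual normalisation of exp \<phi> under Q becomes a bound on exp
  \<phi> divided by the likelihood ratio, under \<open>J\<close>. The factor ln 2 converts bits to
  nats.\<close>

lemma expectation_le_rel_entropy:
  assumes "prob_space J" "prob_space Q" and sets: "sets N = sets Q"
    and T[measurable]: "T \<in> J \<rightarrow>\<^sub>M Q" and N_eq: "distr J Q T = N"
    and rel: "rel_entropy N Q \<le> ennreal R" "R \<ge> 0"
    and int: "integrable J \<phi>"
    and le: "(\<integral>\<^sup>+\<omega>. ennreal (exp (\<phi> \<omega>) / enn2real (RN_deriv Q N (T \<omega>))) \<partial>J) \<le> 1"
  shows "(\<integral>\<omega>. \<phi> \<omega> \<partial>J) \<le> R * ln 2"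
proof -
  interpret J: prob_space J by fact
  interpret Q: prob_space Q by fact
  interpret N: prob_space N unfolding N_eq[symmetric] by (rule J.prob_space_distr) fact
  have "rel_entropy N Q \<noteq> \<infinity>" using rel by (auto simp: top_unique)
  then have ac: "absolutely_continuous Q N" and ied: "integrable N (entropy_density 2 Q N)"
    and KL: "rel_entropy N Q = ennreal (KL_divergence 2 Q N)"
    unfolding rel_entropy_def by (auto split: if_splits)
  have KL_le: "KL_divergence 2 Q N \<le> R"
    using rel unfolding KL by (simp add: ennreal_le_iff)
  obtain D where D[measurable]: "D \<in> borel_measurable Q"
    and RN: "AE x in Q. RN_deriv Q N x = ennreal (D x)"
    and pos: "AE x in N. 0 < D x" and nn: "\<And>x. 0 \<le> D x"
    using Q.real_RN_deriv[OF _ ac sets] N.finite_measure_axioms by metis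
  let ?r = "\<lambda>\<omega>. enn2real (RN_deriv Q N (T \<omega>))"
  have "AE x in N. 0 < enn2real (RN_deriv Q N x)"
    using pos absolutely_continuous_AE[OF sets ac RN] by eventually_elim (simp add: nn)
  then have rpos: "AE \<omega> in J. 0 < ?r \<omega>"
    unfolding N_eq[symmetric] by (subst (asm) AE_distr_iff) (auto simp: N_eq)
  have edm: "entropy_density 2 Q N \<in> borel_measurable Q" by measurable
  have eq: "(\<lambda>\<omega>. entropy_density 2 Q N (T \<omega>)) = (\<lambda>\<omega>. ln (?r \<omega>) / ln 2)"
    by (auto simp: entropy_density_def log_def)
  have iln: "integrable J (\<lambda>\<omega>. ln (?r \<omega>) / ln 2)"
    using ied integrable_distr_eq[OF T edm] unfolding N_eq eq by simp
  have KLJ: "KL_divergence 2 Q N = (\<integral>\<omega>. ln (?r \<omega>) / ln 2 \<partial>J)"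
    unfolding KL_divergence_def using integral_distr[OF T edm] unfolding N_eq eq by simp
  have iln': "integrable J (\<lambda>\<omega>. ln (?r \<omega>))"
    using integrable_mult_left[OF iln, of "ln 2"] by simp
  have [measurable]: "\<phi> \<in> borel_measurable J" using int by auto
  have ie: "integrable J (\<lambda>\<omega>. exp (\<phi> \<omega>) / ?r \<omega>)"
    using le by (intro integrableI_nonneg) (auto simp: order_le_less_trans)
  have "(\<integral>\<omega>. \<phi> \<omega> - ln (?r \<omega>) \<partial>J) \<le> (\<integral>\<omega>. exp (\<phi> \<omega>) / ?r \<omega> - 1 \<partial>J)"
  proof (rule integral_mono_AE)
    show "AE \<omega> in J. \<phi> \<omega> - ln (?r \<omega>) \<le> exp (\<phi> \<omega>) / ?r \<omega> - 1"
      using rpos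
    proof eventually_elim
      case (elim \<omega>)
      then show ?case using ln_le_minus_one[of "exp (\<phi> \<omega>) / ?r \<omega>"] by (simp add: ln_div)
    qed
  qed (use iln' int ie in auto)
  also have "\<dots> = (\<integral>\<omega>. exp (\<phi> \<omega>) / ?r \<omega> \<partial>J) - 1"
    using ie by (simp add: J.prob_space)
  also have "(\<integral>\<omega>. exp (\<phi> \<omega>) / ?r \<omega> \<partial>J) \<le> 1"
    using le by (subst integral_eq_nn_integral) (auto intro: enn2real_leI)
  finally have "(\<integral>\<omega>. \<phi> \<omega> \<partial>J) \<le> (\<integral>\<omega>. ln (?r \<omega>) \<partial>J)" using int iln' by simp
  also have "\<dots> = KL_divergence 2 Q N * ln 2" by (simp add: KLJ)
  also have "\<dots> \<le> R * ln 2" using KL_le by simp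
  finally show ?thesis .
qed

text \<open>Since \<open>N\<close> restricted to \<open>snd = v\<close> is dominated by the first marginal placed on that slice,
  each of the two values contributes at most 1 to the second moment of \<open>dN/dQ\<close>.\<close>

lemma mutual_info_two_valued_le_1:
  fixes a b :: real
  assumes "prob_space N" and sets[measurable_cong]: "sets N = sets (S \<Otimes>\<^sub>M borel)"
    and two: "AE \<omega> in N. snd \<omega> = a \<or> snd \<omega> = b"
  shows "mutual_info N S borel fst snd \<le> 1"
proof -
  interpret N: prob_space N by fact
  define A where "A = distr N S fst"
  define V where "V = distr N borel snd"
  interpret A: prob_space A unfolding A_def by (rule N.prob_space_distr) simp
  interpret V: prob_space V unfolding V_def by (rule N.prob_space_distr) simp
  interpret AV: pair_prob_space A V ..
  let ?Q = "A \<Otimes>\<^sub>M V"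
  have [measurable_cong]: "sets A = sets S" "sets V = sets borel" by (simp_all add: A_def V_def)
  have sQ: "sets N = sets ?Q"
    unfolding sets by (rule sets_pair_measure_cong) (simp_all add: A_def V_def)
  have N_eq: "distr N (S \<Otimes>\<^sub>M borel) (\<lambda>\<omega>. (fst \<omega>, snd \<omega>)) = N"
    by (simp add: distr_id2[OF sets[symmetric]])
  let ?i = "\<lambda>v \<omega>. indicator {v} (snd \<omega>) :: ennreal"
  have on_atom: "(\<integral>\<^sup>+\<omega>. g \<omega> * ?i v \<omega> \<partial>N) \<le> (\<integral>\<^sup>+s. g (s, v) \<partial>A)"
    if [measurable]: "g \<in> borel_measurable (S \<Otimes>\<^sub>M borel)" for g v
  proof -
    have "(\<integral>\<^sup>+s. g (s, v) \<partial>A) = (\<integral>\<^sup>+\<omega>. g (fst \<omega>, v) \<partial>N)"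
      unfolding A_def by (subst nn_integral_distr) auto
    also have "\<dots> \<ge> (\<integral>\<^sup>+\<omega>. g \<omega> * ?i v \<omega> \<partial>N)"
      by (intro nn_integral_mono) (auto simp: indicator_def)
    finally show ?thesis .
  qed
  have Q_atom: "(\<integral>\<^sup>+\<omega>. g \<omega> * ?i v \<omega> \<partial>?Q) = (\<integral>\<^sup>+s. g (s, v) \<partial>A) * emeasure V {v}"
    if [measurable]: "g \<in> borel_measurable (S \<Otimes>\<^sub>M borel)" for g v
  proof -
    have "(\<integral>\<^sup>+\<omega>. g \<omega> * ?i v \<omega> \<partial>?Q) = (\<integral>\<^sup>+w. \<integral>\<^sup>+s. g (s, w) * indicator {v} w \<partial>A \<partial>V)"
      by (subst AV.nn_integral_snd[symmetric]) auto
    also have "\<dots> = (\<integral>\<^sup>+w. (\<integral>\<^sup>+s. g (s, v) \<partial>A) * indicator {v} w \<partial>V)"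
      by (intro nn_integral_cong) (auto simp: indicator_def)
    also have "\<dots> = (\<integral>\<^sup>+s. g (s, v) \<partial>A) * emeasure V {v}"
      by (subst nn_integral_cmult) auto
    finally show ?thesis .
  qed
  have V_atom: "emeasure V {v} = (\<integral>\<^sup>+\<omega>. ?i v \<omega> \<partial>N)" for v
  proof -
    have "(\<integral>\<^sup>+\<omega>. ?i v \<omega> \<partial>N) = (\<integral>\<^sup>+w. indicator {v} w \<partial>V)"
      unfolding V_def by (subst nn_integral_distr) auto
    then show ?thesis by simp
  qed
  \<comment> \<open>An inequality, since a = b is allowed and the atom is then counted
    twice.\<close>
  have split: "(\<integral>\<^sup>+\<omega>. g \<omega> \<partial>N) \<le> (\<integral>\<^sup>+\<omega>. g \<omega> * ?i a \<omega> \<partial>N) + (\<integral>\<^sup>+\<omega>. g \<omega> * ?i b \<omega> \<partial>N)"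
    if [measurable]: "g \<in> borel_measurable (S \<Otimes>\<^sub>M borel)" for g
  proof -
    have "(\<integral>\<^sup>+\<omega>. g \<omega> \<partial>N) \<le> (\<integral>\<^sup>+\<omega>. g \<omega> * ?i a \<omega> + g \<omega> * ?i b \<omega> \<partial>N)"
      using two by (intro nn_integral_mono_AE) (auto elim!: eventually_mono simp: indicator_def)
    then show ?thesis by (subst (asm) nn_integral_add) auto
  qed
  have null_atom: "(\<integral>\<^sup>+\<omega>. g \<omega> * ?i v \<omega> \<partial>N) = 0"
    if "emeasure V {v} = 0" and [measurable]: "g \<in> borel_measurable (S \<Otimes>\<^sub>M borel)" for g v
  proof -
    have "AE \<omega> in N. ?i v \<omega> = 0"
      using that(1) unfolding V_atom by (subst (asm) nn_integral_0_iff_AE) auto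
    then show ?thesis
      by (subst nn_integral_0_iff_AE) (auto elim!: eventually_mono)
  qed
  \<comment> \<open>If v is an atom of V, a Q-null set has an A-null section at v, and
    \<open>on_atom\<close> transfers this to N. If v is not an atom, N puts no mass on the slice at
    all.\<close>
  have ac: "absolutely_continuous ?Q N"
    unfolding absolutely_continuous_def
  proof
    fix E assume E: "E \<in> null_sets ?Q"
    then have [measurable]: "E \<in> sets (S \<Otimes>\<^sub>M borel)" using sQ sets by auto
    have z: "(\<integral>\<^sup>+\<omega>. indicator E \<omega> * ?i v \<omega> \<partial>N) = 0" for v
    proof (cases "emeasure V {v} = 0")
      case False
      have "(\<integral>\<^sup>+\<omega>. indicator E \<omega> * ?i v \<omega> \<partial>?Q) \<le> (\<integral>\<^sup>+\<omega>. indicator E \<omega> \<partial>?Q)"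
        by (intro nn_integral_mono) (auto simp: indicator_def)
      also have "\<dots> = 0" using E by auto
      finally have "(\<integral>\<^sup>+s. indicator E (s, v) \<partial>A) = 0"
        using False by (subst (asm) Q_atom) auto
      then show ?thesis using on_atom[of "indicator E" v] by simp
    qed (auto intro: null_atom)
    have "emeasure N E = (\<integral>\<^sup>+\<omega>. indicator E \<omega> \<partial>N)"
      by (simp add: sets)
    also have "\<dots> \<le> 0" using split[of "indicator E"] by (simp add: z)
    finally show "E \<in> null_sets N" by (auto simp: sets)
  qed
  let ?r = "RN_deriv ?Q N"
  have rm[measurable]: "?r \<in> borel_measurable (S \<Otimes>\<^sub>M borel)"
    using borel_measurable_RN_deriv[of ?Q N] measurable_cong_sets[OF sQ[unfolded sets] refl] by blast
  \<comment> \<open>On an atom v, both \<open>(\<integral>\<^sup>+s. ?r (s, v) \<partial>A) *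
    emeasure V {v}\<close> and \<open>emeasure V {v}\<close> are the N-mass of the slice, so the
    integral over the section is exactly 1. Two slices give second moment at most 2, that is, one
    bit.\<close>
  have r_le: "(\<integral>\<^sup>+\<omega>. ?r \<omega> * ?i v \<omega> \<partial>N) \<le> 1" for v
  proof (cases "emeasure V {v} = 0")
    case False
    have "(\<integral>\<^sup>+s. ?r (s, v) \<partial>A) * emeasure V {v} = (\<integral>\<^sup>+\<omega>. ?r \<omega> * ?i v \<omega> \<partial>?Q)"
      by (rule Q_atom[symmetric]) simp
    also have "\<dots> = (\<integral>\<^sup>+\<omega>. ?i v \<omega> \<partial>N)"
      by (rule AV.RN_deriv_nn_integral[OF ac sQ, symmetric]) auto
    also have "\<dots> = 1 * emeasure V {v}" by (simp add: V_atom)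
    finally have "(\<integral>\<^sup>+s. ?r (s, v) \<partial>A) = 1"
      using False V.emeasure_finite[of "{v}"]
      by (metis ennreal_mult_divide_eq infinity_ennreal_def top.not_eq_extremum)
    then show ?thesis using on_atom[OF rm, of v] by simp
  qed (simp add: null_atom)
  have "(\<integral>\<^sup>+\<omega>. ?r \<omega> \<partial>N) \<le> 1 + 1"
    using split[OF rm] add_mono[OF r_le r_le] by (rule order_trans)
  then have "(\<integral>\<^sup>+\<omega>. ?r \<omega> \<partial>N) \<le> ennreal 2" by simp
  then have "rel_entropy N ?Q \<le> ennreal (log 2 2)"
    by (intro rel_entropy_le_log_second_moment ac sQ) (unfold_locales, auto)
  then show ?thesis
    unfolding mutual_info_def N_eq A_def[symmetric] V_def[symmetric] by simp
qed

section \<open>Gaussian measures and kernels\<close>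

lemma sets_gaussian[simp, measurable_cong]: "sets (gaussian \<mu> \<sigma>) = sets borel"
  by (simp add: gaussian_def)

lemma space_gaussian[simp]: "space (gaussian \<mu> \<sigma>) = UNIV"
  by (simp add: gaussian_def)

lemma prob_space_gaussian: "\<sigma> > 0 \<Longrightarrow> prob_space (gaussian \<mu> \<sigma>)"
  unfolding gaussian_def by (rule prob_space_normal_density)

lemma nn_integral_gaussian:
  "f \<in> borel_measurable borel \<Longrightarrow>
     (\<integral>\<^sup>+x. f x \<partial>gaussian \<mu> \<sigma>) = (\<integral>\<^sup>+x. ennreal (normal_density \<mu> \<sigma> x) * f x \<partial>lborel)"
  unfolding gaussian_def by (subst nn_integral_density) auto

lemma nn_integral_normal_density: "\<sigma> > 0 \<Longrightarrow> (\<integral>\<^sup>+x. ennreal (normal_density \<mu> \<sigma> x) \<partial>lborel) = 1"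
  by (simp add: nn_integral_eq_integral)

lemma nn_integral_gaussian_variance:
  assumes "\<sigma> > 0"
  shows "(\<integral>\<^sup>+x. ennreal ((x - \<mu>)\<^sup>2) \<partial>gaussian \<mu> \<sigma>) = ennreal (\<sigma>\<^sup>2)"
proof -
  have "(\<integral>\<^sup>+x. ennreal ((x - \<mu>)\<^sup>2) \<partial>gaussian \<mu> \<sigma>)
      = (\<integral>\<^sup>+x. ennreal (normal_density \<mu> \<sigma> x * (x - \<mu>) ^ (2 * 1)) \<partial>lborel)"
    by (simp add: nn_integral_gaussian ennreal_mult')
  also have "\<dots> = ennreal (\<integral>x. normal_density \<mu> \<sigma> x * (x - \<mu>) ^ (2 * 1) \<partial>lborel)"
    by (intro nn_integral_eq_integral integrable_normal_moment) (auto simp: assms)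
  also have "\<dots> = ennreal (\<sigma>\<^sup>2)"
    using assms by (subst integral_normal_moment_even) (auto simp: field_simps)
  finally show ?thesis .
qed

lemma ext_expectation_eq_integral:
  assumes "integrable M f"
  shows "ext_expectation M f = ereal (\<integral>x. f x \<partial>M)"
proof -
  have fin: "(\<integral>\<^sup>+x. ennreal (f x) \<partial>M) \<noteq> \<infinity>" "(\<integral>\<^sup>+x. ennreal (- f x) \<partial>M) \<noteq> \<infinity>"
    using assms by (auto simp: real_integrable_def)
  show ?thesis
    unfolding ext_expectation_def real_lebesgue_integral_def[OF assms]
    using fin by (cases "\<integral>\<^sup>+x. ennreal (f x) \<partial>M"; cases "\<integral>\<^sup>+x. ennreal (- f x) \<partial>M") auto
qed

lemma gaussian_in_prob_algebra: "\<sigma> > 0 \<Longrightarrow> gaussian \<mu> \<sigma> \<in> space (prob_algebra borel)"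
  by (simp add: space_prob_algebra prob_space_gaussian)

section \<open>Kernels, conditional laws and the joint law\<close>

lemma nn_integral_bind_pair:
  assumes M: "M \<in> space (prob_algebra C)" and K[measurable]: "\<kappa> \<in> C \<rightarrow>\<^sub>M prob_algebra A"
    and f[measurable]: "f \<in> borel_measurable (C \<Otimes>\<^sub>M A)"
  shows "(\<integral>\<^sup>+\<omega>. f \<omega> \<partial>(M \<bind> (\<lambda>c. \<kappa> c \<bind> (\<lambda>a. return (C \<Otimes>\<^sub>M A) (c, a)))))
    = (\<integral>\<^sup>+c. \<integral>\<^sup>+a. f (c, a) \<partial>\<kappa> c \<partial>M)"
proof -
  have [measurable_cong]: "sets M = sets C" and sp: "space M = space C"
    using M by (auto simp: space_prob_algebra dest: sets_eq_imp_space_eq)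
  have "(\<lambda>c. \<kappa> c \<bind> (\<lambda>a. return (C \<Otimes>\<^sub>M A) (c, a))) \<in> C \<rightarrow>\<^sub>M prob_algebra (C \<Otimes>\<^sub>M A)"
    by measurable
  then have "(\<integral>\<^sup>+\<omega>. f \<omega> \<partial>(M \<bind> (\<lambda>c. \<kappa> c \<bind> (\<lambda>a. return (C \<Otimes>\<^sub>M A) (c, a)))))
    = (\<integral>\<^sup>+c. \<integral>\<^sup>+\<omega>. f \<omega> \<partial>(\<kappa> c \<bind> (\<lambda>a. return (C \<Otimes>\<^sub>M A) (c, a))) \<partial>M)"
    by (intro nn_integral_bind[OF f] measurable_prob_algebraD) (simp cong: measurable_cong_sets)
  also have "\<dots> = (\<integral>\<^sup>+c. \<integral>\<^sup>+a. f (c, a) \<partial>\<kappa> c \<partial>M)"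
  proof (rule nn_integral_cong)
    fix c assume "c \<in> space M"
    then have c[simp]: "c \<in> space C" by (simp add: sp)
    have [measurable_cong]: "sets (\<kappa> c) = sets A" and sk: "space (\<kappa> c) = space A"
      using measurable_space[OF K c] by (auto simp: space_prob_algebra dest: sets_eq_imp_space_eq)
    have "(\<lambda>a. return (C \<Otimes>\<^sub>M A) (c, a)) \<in> \<kappa> c \<rightarrow>\<^sub>M prob_algebra (C \<Otimes>\<^sub>M A)"
      by measurable
    then have "(\<integral>\<^sup>+\<omega>. f \<omega> \<partial>(\<kappa> c \<bind> (\<lambda>a. return (C \<Otimes>\<^sub>M A) (c, a))))
        = (\<integral>\<^sup>+a. \<integral>\<^sup>+\<omega>. f \<omega> \<partial>return (C \<Otimes>\<^sub>M A) (c, a) \<partial>\<kappa> c)"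
      by (intro nn_integral_bind[OF f] measurable_prob_algebraD)
    also have "\<dots> = (\<integral>\<^sup>+a. f (c, a) \<partial>\<kappa> c)"
      by (intro nn_integral_cong nn_integral_return) (auto simp: sk space_pair_measure)
    finally show "(\<integral>\<^sup>+\<omega>. f \<omega> \<partial>(\<kappa> c \<bind> (\<lambda>a. return (C \<Otimes>\<^sub>M A) (c, a)))) = (\<integral>\<^sup>+a. f (c, a) \<partial>\<kappa> c)" .
  qed
  finally show ?thesis .
qed

lemma bind_pair_in_prob_algebra:
  assumes M: "M \<in> space (prob_algebra C)" and K[measurable]: "\<kappa> \<in> C \<rightarrow>\<^sub>M prob_algebra A"
  shows "M \<bind> (\<lambda>c. \<kappa> c \<bind> (\<lambda>a. return (C \<Otimes>\<^sub>M A) (c, a))) \<in> space (prob_algebra (C \<Otimes>\<^sub>M A))"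
proof -
  have K': "(\<lambda>c. \<kappa> c \<bind> (\<lambda>a. return (C \<Otimes>\<^sub>M A) (c, a))) \<in> C \<rightarrow>\<^sub>M prob_algebra (C \<Otimes>\<^sub>M A)"
    by measurable
  show ?thesis
    using prob_space_bind'[OF M K'] sets_bind'[OF M K'] by (simp add: space_prob_algebra)
qed

lemma nn_integral_regular_cond_law:
  assumes rcl: "regular_cond_law P S T A C \<kappa>" and "prob_space P"
    and A[measurable]: "A \<in> P \<rightarrow>\<^sub>M S" and C[measurable]: "C \<in> P \<rightarrow>\<^sub>M T"
    and f[measurable]: "f \<in> borel_measurable (T \<Otimes>\<^sub>M S)"
  shows "(\<integral>\<^sup>+\<omega>. f (C \<omega>, A \<omega>) \<partial>P) = (\<integral>\<^sup>+\<omega>. \<integral>\<^sup>+a. f (C \<omega>, a) \<partial>\<kappa> (C \<omega>) \<partial>P)"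
proof -
  have K: "\<kappa> \<in> T \<rightarrow>\<^sub>M prob_algebra S"
    and eq: "distr P (T \<Otimes>\<^sub>M S) (\<lambda>\<omega>. (C \<omega>, A \<omega>)) =
       distr P T C \<bind> (\<lambda>c. \<kappa> c \<bind> (\<lambda>a. return (T \<Otimes>\<^sub>M S) (c, a)))"
    using rcl by (simp_all add: regular_cond_law_def)
  have D: "distr P T C \<in> space (prob_algebra T)"
    using assms by (simp add: space_prob_algebra prob_space.prob_space_distr)
  have m: "(\<lambda>c. \<integral>\<^sup>+a. f (c, a) \<partial>\<kappa> c) \<in> borel_measurable T"
    by (rule nn_integral_measurable_subprob_algebra2[OF _ measurable_prob_algebraD[OF K]]) simp
  have "(\<integral>\<^sup>+\<omega>. f (C \<omega>, A \<omega>) \<partial>P) = (\<integral>\<^sup>+t. f t \<partial>distr P (T \<Otimes>\<^sub>M S) (\<lambda>\<omega>. (C \<omega>, A \<omega>)))"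
    by (subst nn_integral_distr) auto
  also have "\<dots> = (\<integral>\<^sup>+c. \<integral>\<^sup>+a. f (c, a) \<partial>\<kappa> c \<partial>distr P T C)"
    unfolding eq by (rule nn_integral_bind_pair[OF D K f])
  also have "\<dots> = (\<integral>\<^sup>+\<omega>. \<integral>\<^sup>+a. f (C \<omega>, a) \<partial>\<kappa> (C \<omega>) \<partial>P)"
    by (subst nn_integral_distr) (use m in auto)
  finally show ?thesis .
qed

text \<open>Agreement on indicators already fixes a measure, so a conditional law can be verified as
  an identity of iterated integrals of nonnegative functions, with no integrability to check. All
  conditional laws of the test channel are obtained in this way.\<close>

lemma regular_cond_lawI:
  assumes "prob_space P"
    and A[measurable]: "A \<in> P \<rightarrow>\<^sub>M S" and C[measurable]: "C \<in> P \<rightarrow>\<^sub>M T"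
    and K: "\<kappa> \<in> T \<rightarrow>\<^sub>M prob_algebra S"
    and eq: "\<And>f. f \<in> borel_measurable (T \<Otimes>\<^sub>M S) \<Longrightarrow>
      (\<integral>\<^sup>+\<omega>. f (C \<omega>, A \<omega>) \<partial>P) = (\<integral>\<^sup>+\<omega>. \<integral>\<^sup>+a. f (C \<omega>, a) \<partial>\<kappa> (C \<omega>) \<partial>P)"
  shows "regular_cond_law P S T A C \<kappa>"
proof -
  let ?B = "distr P T C \<bind> (\<lambda>c. \<kappa> c \<bind> (\<lambda>a. return (T \<Otimes>\<^sub>M S) (c, a)))"
  have D: "distr P T C \<in> space (prob_algebra T)"
    using assms by (simp add: space_prob_algebra prob_space.prob_space_distr)
  have sB: "sets ?B = sets (T \<Otimes>\<^sub>M S)"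
    using bind_pair_in_prob_algebra[OF D K] by (simp add: space_prob_algebra)
  have "distr P (T \<Otimes>\<^sub>M S) (\<lambda>\<omega>. (C \<omega>, A \<omega>)) = ?B"
  proof (rule measure_eqI)
    fix E assume "E \<in> sets (distr P (T \<Otimes>\<^sub>M S) (\<lambda>\<omega>. (C \<omega>, A \<omega>)))"
    then have E[measurable]: "E \<in> sets (T \<Otimes>\<^sub>M S)" by simp
    have m: "(\<lambda>c. \<integral>\<^sup>+a. indicator E (c, a) \<partial>\<kappa> c) \<in> borel_measurable T"
      by (rule nn_integral_measurable_subprob_algebra2[OF _ measurable_prob_algebraD[OF K]]) simp
    have "emeasure (distr P (T \<Otimes>\<^sub>M S) (\<lambda>\<omega>. (C \<omega>, A \<omega>))) E
        = (\<integral>\<^sup>+t. indicator E t \<partial>distr P (T \<Otimes>\<^sub>M S) (\<lambda>\<omega>. (C \<omega>, A \<omega>)))"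
      by simp
    also have "\<dots> = (\<integral>\<^sup>+\<omega>. indicator E (C \<omega>, A \<omega>) \<partial>P)"
      by (rule nn_integral_distr) auto
    also have "\<dots> = (\<integral>\<^sup>+\<omega>. \<integral>\<^sup>+a. indicator E (C \<omega>, a) \<partial>\<kappa> (C \<omega>) \<partial>P)"
      by (rule eq) simp
    also have "\<dots> = (\<integral>\<^sup>+c. \<integral>\<^sup>+a. indicator E (c, a) \<partial>\<kappa> c \<partial>distr P T C)"
      by (subst nn_integral_distr) (use m in auto)
    also have "\<dots> = (\<integral>\<^sup>+t. indicator E t \<partial>?B)"
      by (rule nn_integral_bind_pair[OF D K, symmetric]) simp
    also have "\<dots> = emeasure ?B E" by (simp add: sB)
    finally show "emeasure (distr P (T \<Otimes>\<^sub>M S) (\<lambda>\<omega>. (C \<omega>, A \<omega>))) E = emeasure ?B E" .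
  qed (simp add: sB)
  then show ?thesis using K by (simp add: regular_cond_law_def)
qed

lemma joint_law_eq_bind_pair:
  "joint_law \<mu> \<sigma> p = gaussian \<mu> \<sigma> \<bind>
     (\<lambda>x. p x \<bind> (\<lambda>a. return (borel \<Otimes>\<^sub>M borel \<Otimes>\<^sub>M borel \<Otimes>\<^sub>M borel) (x, a)))"
  unfolding joint_law_def by (simp add: case_prod_unfold)

lemma joint_law_in_prob_algebra:
  assumes "\<sigma> > 0" "p \<in> borel \<rightarrow>\<^sub>M prob_algebra (borel \<Otimes>\<^sub>M borel \<Otimes>\<^sub>M borel)"
  shows "joint_law \<mu> \<sigma> p \<in> space (prob_algebra (borel \<Otimes>\<^sub>M borel \<Otimes>\<^sub>M borel \<Otimes>\<^sub>M borel))"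
  unfolding joint_law_eq_bind_pair
  by (rule bind_pair_in_prob_algebra[OF gaussian_in_prob_algebra]) fact+

lemma nn_integral_joint_law:
  assumes "\<sigma> > 0" "p \<in> borel \<rightarrow>\<^sub>M prob_algebra (borel \<Otimes>\<^sub>M borel \<Otimes>\<^sub>M borel)"
    and "f \<in> borel_measurable (borel \<Otimes>\<^sub>M borel \<Otimes>\<^sub>M borel \<Otimes>\<^sub>M borel)"
  shows "(\<integral>\<^sup>+\<omega>. f \<omega> \<partial>joint_law \<mu> \<sigma> p) = (\<integral>\<^sup>+x. \<integral>\<^sup>+a. f (x, a) \<partial>p x \<partial>gaussian \<mu> \<sigma>)"
  unfolding joint_law_eq_bind_pair
  by (rule nn_integral_bind_pair[OF gaussian_in_prob_algebra]) fact+

lemma distr_joint_law_X: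
  assumes "\<sigma> > 0" and p: "p \<in> borel \<rightarrow>\<^sub>M prob_algebra (borel \<Otimes>\<^sub>M borel \<Otimes>\<^sub>M borel)"
  shows "distr (joint_law \<mu> \<sigma> p) borel (\<lambda>(x, y, u, v). x) = gaussian \<mu> \<sigma>"
proof (rule measure_eqI)
  have [measurable_cong]: "sets (joint_law \<mu> \<sigma> p) = sets (borel \<Otimes>\<^sub>M borel \<Otimes>\<^sub>M borel \<Otimes>\<^sub>M borel)"
    using joint_law_in_prob_algebra[OF assms] by (auto simp: space_prob_algebra)
  fix E assume "E \<in> sets (distr (joint_law \<mu> \<sigma> p) borel (\<lambda>(x, y, u, v). x))"
  then have E[measurable]: "E \<in> sets borel" by simp
  have ps: "emeasure (p x) (space (p x)) = 1" for x
    using measurable_space[OF p, of x] by (auto simp: space_prob_algebra intro!: prob_space.emeasure_space_1)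
  have "emeasure (distr (joint_law \<mu> \<sigma> p) borel (\<lambda>(x, y, u, v). x)) E
      = (\<integral>\<^sup>+x. indicator E x \<partial>distr (joint_law \<mu> \<sigma> p) borel (\<lambda>(x, y, u, v). x))"
    by simp
  also have "\<dots> = (\<integral>\<^sup>+\<omega>. indicator E (fst \<omega>) \<partial>joint_law \<mu> \<sigma> p)"
    by (subst nn_integral_distr) (auto simp: case_prod_unfold)
  also have "\<dots> = emeasure (gaussian \<mu> \<sigma>) E"
    by (subst nn_integral_joint_law[OF assms]) (auto simp: ps)
  finally show "emeasure (distr (joint_law \<mu> \<sigma> p) borel (\<lambda>(x, y, u, v). x)) E
      = emeasure (gaussian \<mu> \<sigma>) E" .
qed simp

section \<open>The rate-distortion bound\<close>

text \<open>The Markov chain X - W - Y allows Y to be integrated out by the kernel q(W). What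
  remains is an integral over (X, W) with law N, where the change of measure to Q cancels the
  likelihood ratio. Under the product Q, a Y drawn by q(W) is independent of X, so the bound
  \<open>g_le\<close> for each fixed y finishes the estimate.\<close>

lemma markov_nn_integral_over_RN_deriv_le_1:
  fixes g :: "'x \<times> 'y \<Rightarrow> real"
  assumes "prob_space P" and X[measurable]: "X \<in> P \<rightarrow>\<^sub>M S" and W[measurable]: "W \<in> P \<rightarrow>\<^sub>M T"
    and q[measurable]: "q \<in> T \<rightarrow>\<^sub>M prob_algebra B"
    and markov: "\<And>h. h \<in> borel_measurable (S \<Otimes>\<^sub>M T \<Otimes>\<^sub>M B) \<Longrightarrow>
      (\<integral>\<^sup>+\<omega>. h (X \<omega>, W \<omega>, Y \<omega>) \<partial>P) = (\<integral>\<^sup>+\<omega>. \<integral>\<^sup>+y. h (X \<omega>, W \<omega>, y) \<partial>q (W \<omega>) \<partial>P)"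
    and N: "N = distr P (S \<Otimes>\<^sub>M T) (\<lambda>\<omega>. (X \<omega>, W \<omega>))"
    and Q: "Q = distr P S X \<Otimes>\<^sub>M distr P T W"
    and ac: "absolutely_continuous Q N"
    and g[measurable]: "g \<in> borel_measurable (S \<Otimes>\<^sub>M B)" and g_nn: "\<And>t. g t \<ge> 0"
    and g_le: "\<And>y. y \<in> space B \<Longrightarrow> (\<integral>\<^sup>+x. ennreal (g (x, y)) \<partial>distr P S X) \<le> 1"
  shows "(\<integral>\<^sup>+\<omega>. ennreal (g (X \<omega>, Y \<omega>) / enn2real (RN_deriv Q N (X \<omega>, W \<omega>))) \<partial>P) \<le> 1"
proof -
  interpret P: prob_space P by fact
  interpret PX: prob_space "distr P S X" by (rule P.prob_space_distr) fact
  interpret PW: prob_space "distr P T W" by (rule P.prob_space_distr) fact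
  interpret XW: pair_prob_space "distr P S X" "distr P T W" ..
  interpret Q: prob_space Q
    unfolding Q by (rule prob_space_pair[OF PX.prob_space_axioms PW.prob_space_axioms])
  have sQ[measurable_cong]: "sets Q = sets (S \<Otimes>\<^sub>M T)"
    unfolding Q by (rule sets_pair_measure_cong) simp_all
  have sN: "sets N = sets Q" by (simp add: N sQ)
  let ?r = "\<lambda>t. RN_deriv Q N t"
  have [measurable]: "?r \<in> borel_measurable (S \<Otimes>\<^sub>M T)"
    using borel_measurable_RN_deriv[of Q N] measurable_cong_sets[OF sQ refl] by blast
  have q_sub[measurable]: "q \<in> T \<rightarrow>\<^sub>M subprob_algebra B"
    by (rule measurable_prob_algebraD) fact
  have q_meas: "(\<lambda>(x, w). \<integral>\<^sup>+y. h (x, w, y) \<partial>q w) \<in> borel_measurable (S \<Otimes>\<^sub>M T)"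
    if [measurable]: "h \<in> borel_measurable (S \<Otimes>\<^sub>M T \<Otimes>\<^sub>M B)" for h :: "_ \<Rightarrow> ennreal"
    using nn_integral_measurable_subprob_algebra2[of "\<lambda>(x, w) y. h (x, w, y)" "S \<Otimes>\<^sub>M T" B "\<lambda>(x, w). q w"]
    by (simp add: case_prod_unfold)
  let ?h = "\<lambda>(x, w, y). ennreal (g (x, y) / enn2real (?r (x, w)))"
  define H where "H = (\<lambda>(x, w). \<integral>\<^sup>+y. ?h (x, w, y) \<partial>q w)"
  have [measurable]: "H \<in> borel_measurable (S \<Otimes>\<^sub>M T)"
    using q_meas[of ?h] by (simp add: H_def)
  have "(\<integral>\<^sup>+\<omega>. ?h (X \<omega>, W \<omega>, Y \<omega>) \<partial>P) = (\<integral>\<^sup>+\<omega>. H (X \<omega>, W \<omega>) \<partial>P)"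
    by (subst markov) (auto simp: H_def)
  also have "\<dots> = (\<integral>\<^sup>+t. H t \<partial>distr P (S \<Otimes>\<^sub>M T) (\<lambda>\<omega>. (X \<omega>, W \<omega>)))"
    by (subst nn_integral_distr) auto
  also have "\<dots> = (\<integral>\<^sup>+t. H t \<partial>N)"
    by (simp only: N)
  also have "\<dots> = (\<integral>\<^sup>+t. ?r t * H t \<partial>Q)"
    by (rule Q.RN_deriv_nn_integral[OF ac sN]) measurable
  also have "\<dots> \<le> (\<integral>\<^sup>+t. (\<lambda>(x, w). \<integral>\<^sup>+y. ennreal (g (x, y)) \<partial>q w) t \<partial>Q)"
  proof (rule nn_integral_mono, clarify)
    fix x w assume "(x, w) \<in> space Q"
    then have w: "x \<in> space S" "w \<in> space T"
      using sets_eq_imp_space_eq[OF sQ] by (auto simp: space_pair_measure)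
    have [measurable_cong]: "sets (q w) = sets B"
      using measurable_space[OF q w(2)] by (simp add: space_prob_algebra)
    have [measurable]: "(\<lambda>y. g (x, y)) \<in> borel_measurable B"
      by (rule measurable_compose[OF measurable_Pair1'[OF w(1)] g])
    have "?r (x, w) * H (x, w) = (\<integral>\<^sup>+y. ?r (x, w) * ennreal (g (x, y) / enn2real (?r (x, w))) \<partial>q w)"
      using w by (simp add: H_def nn_integral_cmult)
    \<comment> \<open>Where the ratio is 0 or infinite, \<open>enn2real\<close> returns 0, so g / 0
      = 0 and the left side vanishes; elsewhere the ratio cancels exactly.\<close>
    also have "\<dots> \<le> (\<integral>\<^sup>+y. ennreal (g (x, y)) \<partial>q w)"
      by (intro nn_integral_mono, cases "?r (x, w)")
        (auto simp: ennreal_mult'[symmetric] ennreal_mult_top g_nn)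
    finally show "?r (x, w) * H (x, w) \<le> (\<integral>\<^sup>+y. ennreal (g (x, y)) \<partial>q w)" .
  qed
  also have "\<dots> = (\<integral>\<^sup>+w. \<integral>\<^sup>+x. \<integral>\<^sup>+y. ennreal (g (x, y)) \<partial>q w \<partial>distr P S X \<partial>distr P T W)"
    unfolding Q using q_meas[of "\<lambda>(x, w, y). ennreal (g (x, y))"]
    by (subst XW.nn_integral_snd[symmetric]) (simp_all cong: measurable_cong_sets)
  also have "\<dots> \<le> (\<integral>\<^sup>+w. 1 \<partial>distr P T W)"
  proof (rule nn_integral_mono)
    fix w assume "w \<in> space (distr P T W)"
    then have w: "w \<in> space T" by simp
    have sq[measurable_cong]: "sets (q w) = sets B" and "prob_space (q w)"
      using measurable_space[OF q w] by (simp_all add: space_prob_algebra)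
    then interpret qw: prob_space "q w" by simp
    interpret pp: pair_sigma_finite "distr P S X" "q w" ..
    have "(\<integral>\<^sup>+x. \<integral>\<^sup>+y. ennreal (g (x, y)) \<partial>q w \<partial>distr P S X)
        = (\<integral>\<^sup>+y. \<integral>\<^sup>+x. ennreal (g (x, y)) \<partial>distr P S X \<partial>q w)"
    proof (rule pp.Fubini'[symmetric])
      have "sets (distr P S X \<Otimes>\<^sub>M q w) = sets (S \<Otimes>\<^sub>M B)"
        by (rule sets_pair_measure_cong) (simp_all add: sq)
      then show "(\<lambda>(x, y). ennreal (g (x, y))) \<in> borel_measurable (distr P S X \<Otimes>\<^sub>M q w)"
        by (simp add: case_prod_unfold cong: measurable_cong_sets)
    qed
    also have "\<dots> \<le> (\<integral>\<^sup>+y. 1 \<partial>q w)"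
      using sets_eq_imp_space_eq[OF sq] by (intro nn_integral_mono g_le) auto
    finally show "(\<integral>\<^sup>+x. \<integral>\<^sup>+y. ennreal (g (x, y)) \<partial>q w \<partial>distr P S X) \<le> 1"
      by (simp add: qw.emeasure_space_1)
  qed
  also have "\<dots> = 1" using PW.emeasure_space_1 by simp
  finally show ?thesis by simp
qed

text \<open>Identifies the exponent as the log-likelihood ratio of a Gaussian around y to the source
  law. It serves both halves: in the upper bound it shows that the test function has exponential
  mean 1, and for the optimal channel it gives the density of the joint law of (X, (U, V)) with
  respect to the product of its marginals.\<close>

lemma normal_density_ratio:
  assumes "\<sigma> > 0" "\<tau> > 0"
  shows "normal_density \<mu> \<sigma> x * exp (ln (\<sigma> / \<tau>) - (y - x)\<^sup>2 / (2 * \<tau>\<^sup>2) + (x - \<mu>)\<^sup>2 / (2 * \<sigma>\<^sup>2))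
    = normal_density y \<tau> x"
proof -
  have "exp (a - b + c) = exp a * (exp (- b) / exp (- c))" for a b c :: real
    by (simp add: exp_add exp_diff exp_minus field_simps)
  from this[of "ln (\<sigma> / \<tau>)" "(y - x)\<^sup>2 / (2 * \<tau>\<^sup>2)" "(x - \<mu>)\<^sup>2 / (2 * \<sigma>\<^sup>2)"]
  have "exp (ln (\<sigma> / \<tau>) - (y - x)\<^sup>2 / (2 * \<tau>\<^sup>2) + (x - \<mu>)\<^sup>2 / (2 * \<sigma>\<^sup>2))
     = \<sigma> / \<tau> * (exp (- (x - y)\<^sup>2 / (2 * \<tau>\<^sup>2)) / exp (- (x - \<mu>)\<^sup>2 / (2 * \<sigma>\<^sup>2)))"
    using assms by (simp add: power2_commute)
  then show ?thesis
    using assms by (simp add: normal_density_def real_sqrt_mult)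
qed

text \<open>The positive part of the payoff is at most (X - c)^2 / \<sigma>^2, which is integrable,
  so the negative part must absorb all of Bob's infinite distortion and no difference of infinities
  arises.\<close>

lemma ext_expectation_payoff_eq_MInf:
  assumes [measurable]: "X \<in> borel_measurable J" "Y \<in> borel_measurable J"
    and "\<sigma> > 0" and X: "(\<integral>\<^sup>+\<omega>. ennreal ((X \<omega> - c)\<^sup>2) \<partial>J) < \<infinity>"
    and Y: "(\<integral>\<^sup>+\<omega>. ennreal ((Y \<omega> - X \<omega>)\<^sup>2) \<partial>J) = \<infinity>"
  shows "ext_expectation J (\<lambda>\<omega>. payoff \<sigma> (X \<omega>) (Y \<omega>) c) = -\<infinity>"
proof -
  let ?f = "\<lambda>\<omega>. payoff \<sigma> (X \<omega>) (Y \<omega>) c"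
  have [measurable]: "?f \<in> borel_measurable J" unfolding payoff_def by measurable
  have scale: "(\<integral>\<^sup>+\<omega>. ennreal (h \<omega> / \<sigma>\<^sup>2) \<partial>J) = ennreal (1 / \<sigma>\<^sup>2) * (\<integral>\<^sup>+\<omega>. ennreal (h \<omega>) \<partial>J)"
    if [measurable]: "h \<in> borel_measurable J" for h
    by (subst nn_integral_cmult[symmetric]) (auto simp: ennreal_mult'[symmetric])
  have X': "(\<integral>\<^sup>+\<omega>. ennreal ((X \<omega> - c)\<^sup>2 / \<sigma>\<^sup>2) \<partial>J) < \<infinity>"
    using X by (simp add: scale ennreal_mult_less_top)
  have Y': "(\<integral>\<^sup>+\<omega>. ennreal ((Y \<omega> - X \<omega>)\<^sup>2 / \<sigma>\<^sup>2) \<partial>J) = \<infinity>"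
    using Y \<open>\<sigma> > 0\<close> by (simp add: scale ennreal_mult_top)
  have "(\<integral>\<^sup>+\<omega>. ennreal (?f \<omega>) \<partial>J) \<le> (\<integral>\<^sup>+\<omega>. ennreal ((X \<omega> - c)\<^sup>2 / \<sigma>\<^sup>2) \<partial>J)"
    by (intro nn_integral_mono ennreal_leI)
      (auto simp: payoff_def power2_commute divide_right_mono)
  then have pos: "(\<integral>\<^sup>+\<omega>. ennreal (?f \<omega>) \<partial>J) < \<infinity>" using X' by (rule order_le_less_trans)
  have "(\<integral>\<^sup>+\<omega>. ennreal ((Y \<omega> - X \<omega>)\<^sup>2 / \<sigma>\<^sup>2) \<partial>J)
      \<le> (\<integral>\<^sup>+\<omega>. ennreal (- ?f \<omega>) + ennreal ((X \<omega> - c)\<^sup>2 / \<sigma>\<^sup>2) \<partial>J)"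
  proof (rule nn_integral_mono)
    fix \<omega>
    have "(Y \<omega> - X \<omega>)\<^sup>2 / \<sigma>\<^sup>2 = - ?f \<omega> + (X \<omega> - c)\<^sup>2 / \<sigma>\<^sup>2"
      by (simp add: payoff_def power2_commute field_simps diff_divide_distrib)
    also have "ennreal \<dots> \<le> ennreal (- ?f \<omega>) + ennreal ((X \<omega> - c)\<^sup>2 / \<sigma>\<^sup>2)"
      by (simp add: ennreal_plus_if ennreal_leI)
    finally show "ennreal ((Y \<omega> - X \<omega>)\<^sup>2 / \<sigma>\<^sup>2)
        \<le> ennreal (- ?f \<omega>) + ennreal ((X \<omega> - c)\<^sup>2 / \<sigma>\<^sup>2)" .
  qed
  also have "\<dots> = (\<integral>\<^sup>+\<omega>. ennreal (- ?f \<omega>) \<partial>J) + (\<integral>\<^sup>+\<omega>. ennreal ((X \<omega> - c)\<^sup>2 / \<sigma>\<^sup>2) \<partial>J)"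
    by (rule nn_integral_add) measurable
  finally have neg: "(\<integral>\<^sup>+\<omega>. ennreal (- ?f \<omega>) \<partial>J) = \<infinity>"
    using X' unfolding Y' by (auto simp: top_unique)
  show ?thesis
    unfolding ext_expectation_def neg using pos
    by (cases "\<integral>\<^sup>+\<omega>. ennreal (?f \<omega>) \<partial>J") auto
qed

lemma single_letter_value_le:
  assumes \<sigma>: "\<sigma> > 0" and R: "R \<ge> 0" and p: "p \<in> admissible \<mu> \<sigma> R Rs"
  shows "single_letter_value \<mu> \<sigma> p \<le> ereal (1 - 2 powr (- 2 * R))"
proof -
  let ?B = "borel \<Otimes>\<^sub>M borel \<Otimes>\<^sub>M borel \<Otimes>\<^sub>M borel :: (real \<times> real \<times> real \<times> real) measure"
  let ?T = "borel \<Otimes>\<^sub>M borel :: (real \<times> real) measure"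
  let ?J = "joint_law \<mu> \<sigma> p"
  define X :: "real \<times> real \<times> real \<times> real \<Rightarrow> real" where "X = (\<lambda>(x, y, u, v). x)"
  define Y :: "real \<times> real \<times> real \<times> real \<Rightarrow> real" where "Y = (\<lambda>(x, y, u, v). y)"
  define W :: "real \<times> real \<times> real \<times> real \<Rightarrow> real \<times> real" where "W = (\<lambda>(x, y, u, v). (u, v))"
  define C :: "real \<times> real \<times> real \<times> real \<Rightarrow> real \<times> real \<times> real" where "C = (\<lambda>(x, y, u, v). (u, v, x))"
  have pm: "p \<in> borel \<rightarrow>\<^sub>M prob_algebra (borel \<Otimes>\<^sub>M borel \<Otimes>\<^sub>M borel)"
    using p by (simp add: admissible_def)
  from p obtain q where
    q1: "regular_cond_law ?J borel (borel \<Otimes>\<^sub>M borel \<Otimes>\<^sub>M borel) Y C (\<lambda>(u, v, x). q (u, v))"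
    and q2: "regular_cond_law ?J borel ?T Y W q"
    and mi: "mutual_info ?J borel ?T X W \<le> ennreal R"
    unfolding admissible_def Let_def X_def Y_def W_def C_def by (auto simp: case_prod_unfold)
  have q[measurable]: "q \<in> ?T \<rightarrow>\<^sub>M prob_algebra borel"
    using q2 by (simp add: regular_cond_law_def)
  have J: "?J \<in> space (prob_algebra ?B)" by (rule joint_law_in_prob_algebra) fact+
  interpret J: prob_space ?J using J by (simp add: space_prob_algebra)
  have sJ[measurable_cong]: "sets ?J = sets ?B" using J by (simp add: space_prob_algebra)
  have [measurable]: "X \<in> ?J \<rightarrow>\<^sub>M borel" "Y \<in> ?J \<rightarrow>\<^sub>M borel" "W \<in> ?J \<rightarrow>\<^sub>M ?T"
    "C \<in> ?J \<rightarrow>\<^sub>M borel \<Otimes>\<^sub>M borel \<Otimes>\<^sub>M borel"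
    unfolding X_def Y_def W_def C_def by measurable
  have XW: "W \<omega> = (fst (C \<omega>), fst (snd (C \<omega>)))" "X \<omega> = snd (snd (C \<omega>))" for \<omega>
    by (auto simp: X_def W_def C_def split: prod.split)
  have distr_X: "distr ?J borel X = gaussian \<mu> \<sigma>"
    unfolding X_def by (rule distr_joint_law_X) fact+
  \<comment> \<open>\<open>q1\<close> says that the law of Y given (U, V, X) is q(U, V). The
    coordinates of the conditioning triple are permuted here from (u, v, x) to (x, (u, v)).\<close>
  have markov: "(\<integral>\<^sup>+\<omega>. h (X \<omega>, W \<omega>, Y \<omega>) \<partial>?J) = (\<integral>\<^sup>+\<omega>. \<integral>\<^sup>+y. h (X \<omega>, W \<omega>, y) \<partial>q (W \<omega>) \<partial>?J)"
    if [measurable]: "h \<in> borel_measurable (borel \<Otimes>\<^sub>M ?T \<Otimes>\<^sub>M borel)" for h :: "_ \<Rightarrow> ennreal"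
    using nn_integral_regular_cond_law[OF q1 J.prob_space_axioms, where
        f = "\<lambda>(c, y). h (snd (snd c), (fst c, fst (snd c)), y)"]
    by (simp add: XW case_prod_unfold)
  define N where "N = distr ?J (borel \<Otimes>\<^sub>M ?T) (\<lambda>\<omega>. (X \<omega>, W \<omega>))"
  define Q where "Q = distr ?J borel X \<Otimes>\<^sub>M distr ?J ?T W"
  have rel: "rel_entropy N Q \<le> ennreal R" using mi by (simp add: mutual_info_def N_def Q_def)
  then have ac: "absolutely_continuous Q N"
    unfolding rel_entropy_def by (auto split: if_splits simp: top_unique)
  \<comment> \<open>\<tau>^2 is the Gaussian distortion-rate function at R: the choice makes the
    constant term \<open>ln (\<sigma> / \<tau>)\<close> of \<phi> equal to the rate in nats.\<close>
  define \<tau> where "\<tau> = \<sigma> * 2 powr (- R)"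
  have \<tau>: "\<tau> > 0" using \<sigma> by (simp add: \<tau>_def)
  have ln_ratio: "ln (\<sigma> / \<tau>) = R * ln 2"
    using \<sigma> by (simp add: \<tau>_def ln_div ln_mult ln_powr)
  have \<tau>2: "\<tau>\<^sup>2 = \<sigma>\<^sup>2 * 2 powr (- 2 * R)"
    by (simp add: \<tau>_def power_mult_distrib power2_eq_square powr_add[symmetric])
  define \<phi> where "\<phi> x y = ln (\<sigma> / \<tau>) - (y - x)\<^sup>2 / (2 * \<tau>\<^sup>2) + (x - \<mu>)\<^sup>2 / (2 * \<sigma>\<^sup>2)" for x y :: real
  have [measurable]: "(\<lambda>t. \<phi> (fst t) (snd t)) \<in> borel_measurable (borel \<Otimes>\<^sub>M borel)"
    unfolding \<phi>_def by measurable
  have exp_le: "(\<integral>\<^sup>+x. ennreal (exp (\<phi> x y)) \<partial>distr ?J borel X) \<le> 1" for y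
  proof -
    have "(\<integral>\<^sup>+x. ennreal (exp (\<phi> x y)) \<partial>distr ?J borel X)
        = (\<integral>\<^sup>+x. ennreal (normal_density \<mu> \<sigma> x * exp (\<phi> x y)) \<partial>lborel)"
      unfolding distr_X by (subst nn_integral_gaussian) (auto simp: \<phi>_def ennreal_mult')
    also have "\<dots> = 1"
      unfolding \<phi>_def normal_density_ratio[OF \<sigma> \<tau>] by (rule nn_integral_normal_density[OF \<tau>])
    finally show ?thesis by simp
  qed
  have le1: "(\<integral>\<^sup>+\<omega>. ennreal (exp (\<phi> (X \<omega>) (Y \<omega>)) / enn2real (RN_deriv Q N (X \<omega>, W \<omega>))) \<partial>?J) \<le> 1"
    using markov_nn_integral_over_RN_deriv_le_1[where g = "\<lambda>t. exp (\<phi> (fst t) (snd t))" and Y = Y,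
        OF J.prob_space_axioms _ _ q markov N_def Q_def ac] exp_le
    by simp
  have X2: "(\<integral>\<^sup>+\<omega>. ennreal ((X \<omega> - \<mu>)\<^sup>2) \<partial>?J) = ennreal (\<sigma>\<^sup>2)"
    using nn_integral_gaussian_variance[OF \<sigma>, of \<mu>] unfolding distr_X[symmetric]
    by (subst (asm) nn_integral_distr) auto
  have iX: "integrable ?J (\<lambda>\<omega>. (X \<omega> - \<mu>)\<^sup>2)" and EX: "(\<integral>\<omega>. (X \<omega> - \<mu>)\<^sup>2 \<partial>?J) = \<sigma>\<^sup>2"
    using X2 by (auto intro!: integrableI_nonneg simp: integral_eq_nn_integral)
  \<comment> \<open>The test function \<phi> contains Bob's squared error, so the entropy argument
    requires finite distortion; infinite distortion already yields the value -\<infinity>.\<close>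
  have "ext_expectation ?J (\<lambda>\<omega>. payoff \<sigma> (X \<omega>) (Y \<omega>) \<mu>) \<le> ereal (1 - 2 powr (- 2 * R))"
  proof (cases "(\<integral>\<^sup>+\<omega>. ennreal ((Y \<omega> - X \<omega>)\<^sup>2) \<partial>?J) = \<infinity>")
    case True
    then show ?thesis using X2 \<sigma> by (subst ext_expectation_payoff_eq_MInf) auto
  next
    case False
    then have iY: "integrable ?J (\<lambda>\<omega>. (Y \<omega> - X \<omega>)\<^sup>2)"
      by (intro integrableI_nonneg) (auto simp: less_top)
    define d where "d = (\<integral>\<omega>. (Y \<omega> - X \<omega>)\<^sup>2 \<partial>?J)"
    have i\<phi>: "integrable ?J (\<lambda>\<omega>. \<phi> (X \<omega>) (Y \<omega>))"
      unfolding \<phi>_def using iX iY by auto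
    have "(\<integral>\<omega>. \<phi> (X \<omega>) (Y \<omega>) \<partial>?J) \<le> R * ln 2"
    proof (rule expectation_le_rel_entropy[OF J.prob_space_axioms _ _ _ _ rel R i\<phi> le1])
      show "prob_space Q"
        unfolding Q_def by (intro prob_space_pair J.prob_space_distr) measurable
      show "(\<lambda>\<omega>. (X \<omega>, W \<omega>)) \<in> ?J \<rightarrow>\<^sub>M Q" unfolding Q_def by simp
      have sQ: "sets Q = sets (borel \<Otimes>\<^sub>M ?T)" unfolding Q_def by (rule sets_pair_measure_cong) simp_all
      then show "sets N = sets Q" by (simp add: N_def)
      show "distr ?J Q (\<lambda>\<omega>. (X \<omega>, W \<omega>)) = N"
        unfolding N_def by (rule distr_cong) (simp_all add: sQ)
    qed
    \<comment> \<open>The last term is 1/2 and the rate term cancels against the bound, so d / (2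
      \<tau>^2) is at least 1/2.\<close>
    also have "(\<integral>\<omega>. \<phi> (X \<omega>) (Y \<omega>) \<partial>?J) = R * ln 2 - d / (2 * \<tau>\<^sup>2) + \<sigma>\<^sup>2 / (2 * \<sigma>\<^sup>2)"
      unfolding \<phi>_def using iX iY EX by (simp add: d_def ln_ratio J.prob_space)
    finally have "\<tau>\<^sup>2 \<le> d" using \<sigma> \<tau> by (simp add: field_simps)
    then have d: "2 powr (- 2 * R) \<le> d / \<sigma>\<^sup>2" using \<sigma> by (simp add: \<tau>2 field_simps)
    have eq: "(\<lambda>\<omega>. payoff \<sigma> (X \<omega>) (Y \<omega>) \<mu>) = (\<lambda>\<omega>. ((X \<omega> - \<mu>)\<^sup>2 - (Y \<omega> - X \<omega>)\<^sup>2) / \<sigma>\<^sup>2)"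
      by (simp add: payoff_def power2_commute)
    have "ext_expectation ?J (\<lambda>\<omega>. payoff \<sigma> (X \<omega>) (Y \<omega>) \<mu>) = ereal ((\<sigma>\<^sup>2 - d) / \<sigma>\<^sup>2)"
      unfolding eq using iX iY EX by (subst ext_expectation_eq_integral) (auto simp: d_def)
    then show ?thesis using d \<sigma> by (simp add: diff_divide_distrib)
  qed
  then show ?thesis
    unfolding single_letter_value_def X_def Y_def
    by (intro INF_lower2[of "\<lambda>_. \<mu>"]) (auto simp: case_prod_unfold)
qed

section \<open>The optimal test channel\<close>

lemma rel_entropy_density:
  assumes "prob_space Q" "prob_space (density Q (\<lambda>x. ennreal (r x)))"
    and r[measurable]: "r \<in> borel_measurable Q" and pos: "\<And>x. r x > 0"
    and int: "integrable (density Q (\<lambda>x. ennreal (r x))) (\<lambda>x. log 2 (r x))"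
  shows "rel_entropy (density Q (\<lambda>x. ennreal (r x))) Q
    = ennreal (\<integral>x. log 2 (r x) \<partial>density Q (\<lambda>x. ennreal (r x)))"
proof -
  interpret Q: prob_space Q by fact
  let ?N = "density Q (\<lambda>x. ennreal (r x))"
  have ac: "absolutely_continuous Q ?N"
    by (rule absolutely_continuousI_density) simp
  have ae: "AE x in Q. ennreal (r x) = RN_deriv Q ?N x"
    by (rule Q.RN_deriv_unique) simp_all
  have "AE x in ?N. ennreal (r x) = RN_deriv Q ?N x"
    by (rule absolutely_continuous_AE[OF _ ac ae]) simp
  then have ed: "AE x in ?N. log 2 (r x) = entropy_density 2 Q ?N x"
  proof eventually_elim
    case (elim x)
    then have "enn2real (RN_deriv Q ?N x) = r x"
      using pos[of x] by (metis enn2real_ennreal less_imp_le)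
    then show ?case by (simp add: entropy_density_def)
  qed
  have [measurable]: "entropy_density 2 Q ?N \<in> borel_measurable ?N" by simp
  have "integrable ?N (entropy_density 2 Q ?N)"
    by (rule integrable_cong_AE_imp[OF int _ ed]) simp
  moreover have "KL_divergence 2 Q ?N = (\<integral>x. log 2 (r x) \<partial>?N)"
    unfolding KL_divergence_def
    by (rule integral_cong_AE) (use ed in \<open>auto elim: eventually_mono\<close>)
  ultimately show ?thesis using ac by (simp add: rel_entropy_def)
qed

text \<open>Used in two ways: with c = 2 \<mu> it is the symmetry of the channel about \<mu>, and
  with mean 0 it presents every \<open>gaussian y \<tau>\<close> as an image of one fixed
  law.\<close>

lemma nn_integral_gaussian_reflect:
  assumes "\<tau> > 0" and [measurable]: "f \<in> borel_measurable borel"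
  shows "(\<integral>\<^sup>+x. f (c - x) \<partial>gaussian y \<tau>) = (\<integral>\<^sup>+x. f x \<partial>gaussian (c - y) \<tau>)"
proof -
  have "(\<integral>\<^sup>+x. f x \<partial>gaussian (c - y) \<tau>) =
      (\<integral>\<^sup>+x. ennreal (normal_density (c - y) \<tau> x) * f x \<partial>lborel)"
    by (rule nn_integral_gaussian) simp
  also have "\<dots> = (\<integral>\<^sup>+x. ennreal (normal_density (c - y) \<tau> (c - x)) * f (c - x) \<partial>lborel)"
    by (subst nn_integral_real_affine[where c = "-1" and t = c]) auto
  also have "\<dots> = (\<integral>\<^sup>+x. ennreal (normal_density y \<tau> x) * f (c - x) \<partial>lborel)"
  proof -
    have "(c - x - (c - y))\<^sup>2 = (x - y)\<^sup>2" for x by (simp add: power2_eq_square algebra_simps)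
    then show ?thesis by (simp add: normal_density_def)
  qed
  also have "\<dots> = (\<integral>\<^sup>+x. f (c - x) \<partial>gaussian y \<tau>)"
    by (rule nn_integral_gaussian[symmetric]) simp
  finally show ?thesis ..
qed

text \<open>\<open>gaussian y \<tau>\<close> is the image of the fixed measure
  \<open>gaussian 0 \<tau>\<close> under x \<mapsto> y - x, which is jointly measurable in y and x;
  the parameter is thereby moved from the measure into the map.\<close>

lemma measurable_gaussian_mean:
  assumes "\<tau> > 0"
  shows "(\<lambda>y. gaussian y \<tau>) \<in> borel \<rightarrow>\<^sub>M prob_algebra borel"
proof -
  have "gaussian y \<tau> = distr (gaussian 0 \<tau>) borel (\<lambda>x. y - x)" for y
  proof (rule measure_eqI)
    fix E assume "E \<in> sets (gaussian y \<tau>)"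
    then have E: "E \<in> sets borel" by simp
    then have "emeasure (gaussian y \<tau>) E = (\<integral>\<^sup>+x. indicator E (y - x) \<partial>gaussian 0 \<tau>)"
      using nn_integral_gaussian_reflect[OF assms, where f = "indicator E" and c = y and y = 0] by simp
    also have "\<dots> = (\<integral>\<^sup>+x. indicator E x \<partial>distr (gaussian 0 \<tau>) borel (\<lambda>x. y - x))"
      using E by (subst nn_integral_distr) auto
    also have "\<dots> = emeasure (distr (gaussian 0 \<tau>) borel (\<lambda>x. y - x)) E"
      using E by simp
    finally show "emeasure (gaussian y \<tau>) E = emeasure (distr (gaussian 0 \<tau>) borel (\<lambda>x. y - x)) E" .
  qed simp
  then have "(\<lambda>y. gaussian y \<tau>) = (\<lambda>y. distr (gaussian 0 \<tau>) borel (\<lambda>x. y - x))"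
    by (rule ext)
  also have "\<dots> \<in> borel \<rightarrow>\<^sub>M prob_algebra borel"
    by (rule measurable_distr_prob_space2[where M = borel, OF measurable_const])
      (simp_all add: gaussian_in_prob_algebra assms)
  finally show ?thesis .
qed

text \<open>The counterpart for Eve: her guess z(U) is an arbitrary measurable function and may have
  infinite squared error. With Bob's distortion finite, the negative part stays integrable and such
  a guess can only hurt her.\<close>

lemma ext_expectation_payoff_eq_PInf:
  assumes [measurable]: "X \<in> borel_measurable J" "Y \<in> borel_measurable J" "Z \<in> borel_measurable J"
    and "\<sigma> > 0" and Y: "(\<integral>\<^sup>+\<omega>. ennreal ((Y \<omega> - X \<omega>)\<^sup>2) \<partial>J) < \<infinity>"
    and Z: "(\<integral>\<^sup>+\<omega>. ennreal ((Z \<omega> - X \<omega>)\<^sup>2) \<partial>J) = \<infinity>"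
  shows "ext_expectation J (\<lambda>\<omega>. payoff \<sigma> (X \<omega>) (Y \<omega>) (Z \<omega>)) = \<infinity>"
proof -
  let ?f = "\<lambda>\<omega>. payoff \<sigma> (X \<omega>) (Y \<omega>) (Z \<omega>)"
  have [measurable]: "?f \<in> borel_measurable J" unfolding payoff_def by measurable
  have scale: "(\<integral>\<^sup>+\<omega>. ennreal (h \<omega> / \<sigma>\<^sup>2) \<partial>J) = ennreal (1 / \<sigma>\<^sup>2) * (\<integral>\<^sup>+\<omega>. ennreal (h \<omega>) \<partial>J)"
    if [measurable]: "h \<in> borel_measurable J" for h
    by (subst nn_integral_cmult[symmetric]) (auto simp: ennreal_mult'[symmetric])
  have Y': "(\<integral>\<^sup>+\<omega>. ennreal ((Y \<omega> - X \<omega>)\<^sup>2 / \<sigma>\<^sup>2) \<partial>J) < \<infinity>"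
    using Y by (simp add: scale ennreal_mult_less_top)
  have Z': "(\<integral>\<^sup>+\<omega>. ennreal ((Z \<omega> - X \<omega>)\<^sup>2 / \<sigma>\<^sup>2) \<partial>J) = \<infinity>"
    using Z \<open>\<sigma> > 0\<close> by (simp add: scale ennreal_mult_top)
  have "(\<integral>\<^sup>+\<omega>. ennreal (- ?f \<omega>) \<partial>J) \<le> (\<integral>\<^sup>+\<omega>. ennreal ((Y \<omega> - X \<omega>)\<^sup>2 / \<sigma>\<^sup>2) \<partial>J)"
    by (intro nn_integral_mono ennreal_leI) (auto simp: payoff_def diff_divide_distrib)
  then have neg: "(\<integral>\<^sup>+\<omega>. ennreal (- ?f \<omega>) \<partial>J) < \<infinity>" using Y' by (rule order_le_less_trans)
  have "(\<integral>\<^sup>+\<omega>. ennreal ((Z \<omega> - X \<omega>)\<^sup>2 / \<sigma>\<^sup>2) \<partial>J)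
      \<le> (\<integral>\<^sup>+\<omega>. ennreal (?f \<omega>) + ennreal ((Y \<omega> - X \<omega>)\<^sup>2 / \<sigma>\<^sup>2) \<partial>J)"
  proof (rule nn_integral_mono)
    fix \<omega>
    have "(Z \<omega> - X \<omega>)\<^sup>2 / \<sigma>\<^sup>2 = ?f \<omega> + (Y \<omega> - X \<omega>)\<^sup>2 / \<sigma>\<^sup>2"
      by (simp add: payoff_def diff_divide_distrib)
    also have "ennreal \<dots> \<le> ennreal (?f \<omega>) + ennreal ((Y \<omega> - X \<omega>)\<^sup>2 / \<sigma>\<^sup>2)"
      by (simp add: ennreal_plus_if ennreal_leI)
    finally show "ennreal ((Z \<omega> - X \<omega>)\<^sup>2 / \<sigma>\<^sup>2)
        \<le> ennreal (?f \<omega>) + ennreal ((Y \<omega> - X \<omega>)\<^sup>2 / \<sigma>\<^sup>2)" .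
  qed
  also have "\<dots> = (\<integral>\<^sup>+\<omega>. ennreal (?f \<omega>) \<partial>J) + (\<integral>\<^sup>+\<omega>. ennreal ((Y \<omega> - X \<omega>)\<^sup>2 / \<sigma>\<^sup>2) \<partial>J)"
    by (rule nn_integral_add) measurable
  finally have pos: "(\<integral>\<^sup>+\<omega>. ennreal (?f \<omega>) \<partial>J) = \<infinity>"
    using Y' unfolding Z' by (auto simp: top_unique)
  show ?thesis
    unfolding ext_expectation_def pos using neg
    by (cases "\<integral>\<^sup>+\<omega>. ennreal (- ?f \<omega>) \<partial>J") auto
qed

text \<open>\<open>\<nu>\<close> is the law of \<open>Y\<close>, and \<open>X\<close> given \<open>Y = y\<close> has law \<open>gaussian y \<tau>\<close>.  Leaving \<open>\<nu>\<close>
  general covers \<open>R = 0\<close>, where \<open>Y\<close> is constant and has no density.\<close>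

locale symmetric_backward_channel =
  fixes \<mu> \<sigma> \<tau> :: real and p :: test_channel and \<nu> :: "real measure"
  assumes \<sigma>: "\<sigma> > 0" and \<tau>: "\<tau> > 0"
    and p: "p \<in> borel \<rightarrow>\<^sub>M prob_algebra (borel \<Otimes>\<^sub>M borel \<Otimes>\<^sub>M borel)"
    and \<nu>: "\<nu> \<in> space (prob_algebra borel)"
    and sym: "distr \<nu> borel (\<lambda>y. 2 * \<mu> - y) = \<nu>"
    and nn_integral_J: "\<And>f. f \<in> borel_measurable (borel \<Otimes>\<^sub>M borel \<Otimes>\<^sub>M borel \<Otimes>\<^sub>M borel) \<Longrightarrow>
      (\<integral>\<^sup>+\<omega>. f \<omega> \<partial>joint_law \<mu> \<sigma> p) =
      (\<integral>\<^sup>+y. \<integral>\<^sup>+x. f (x, y, \<bar>y - \<mu>\<bar>, y) \<partial>gaussian y \<tau> \<partial>\<nu>)"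
begin

abbreviation "J \<equiv> joint_law \<mu> \<sigma> p"
abbreviation "X \<equiv> (\<lambda>(x, y, u, v). x) :: real \<times> real \<times> real \<times> real \<Rightarrow> real"
abbreviation "Y \<equiv> (\<lambda>(x, y, u, v). y) :: real \<times> real \<times> real \<times> real \<Rightarrow> real"
abbreviation "U \<equiv> (\<lambda>(x, y, u, v). u) :: real \<times> real \<times> real \<times> real \<Rightarrow> real"
abbreviation "V \<equiv> (\<lambda>(x, y, u, v). v) :: real \<times> real \<times> real \<times> real \<Rightarrow> real"

lemma sets_J[measurable_cong]: "sets J = sets (borel \<Otimes>\<^sub>M borel \<Otimes>\<^sub>M borel \<Otimes>\<^sub>M borel)"
  and prob_space_J: "prob_space J"
  using joint_law_in_prob_algebra[OF \<sigma> p] by (simp_all add: space_prob_algebra)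

lemma sets_\<nu>[measurable_cong]: "sets \<nu> = sets borel" and prob_space_\<nu>: "prob_space \<nu>"
  using \<nu> by (simp_all add: space_prob_algebra)

lemma emeasure_gaussian_UNIV: "emeasure (gaussian y \<tau>) UNIV = 1"
  using prob_space.emeasure_space_1[OF prob_space_gaussian[OF \<tau>]] by simp

lemma measurable_nn_integral_gaussian:
  assumes "(\<lambda>(y, x). f y x) \<in> borel_measurable (borel \<Otimes>\<^sub>M borel)"
  shows "(\<lambda>y. \<integral>\<^sup>+x. f y x \<partial>gaussian y \<tau>) \<in> borel_measurable borel"
  by (rule nn_integral_measurable_subprob_algebra2[OF assms
        measurable_prob_algebraD[OF measurable_gaussian_mean[OF \<tau>]]])

lemma nn_integral_reflect_\<nu>:
  "f \<in> borel_measurable borel \<Longrightarrow> (\<integral>\<^sup>+y. f (2 * \<mu> - y) \<partial>\<nu>) = (\<integral>\<^sup>+y. f y \<partial>\<nu>)"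
  by (subst (2) sym[symmetric], subst nn_integral_distr) auto

lemma AE_J: "AE (x, y, u, v) in J. y = v \<and> u = \<bar>v - \<mu>\<bar>"
proof -
  let ?f = "\<lambda>(x, y, u, v). indicator {(a, b). \<not> (a = b)} (y, v) + indicator {(a, b). \<not> (a = b)} (u, \<bar>v - \<mu>\<bar>) :: ennreal"
  have "(\<integral>\<^sup>+\<omega>. ?f \<omega> \<partial>J) = 0"
    by (subst nn_integral_J) auto
  then have "AE \<omega> in J. ?f \<omega> = 0"
    by (subst (asm) nn_integral_0_iff_AE) auto
  then show ?thesis
    by eventually_elim (auto simp: indicator_def split: if_splits)
qed

lemma distr_J_X: "distr J borel X = gaussian \<mu> \<sigma>"
  by (rule distr_joint_law_X[OF \<sigma> p])

section \<open>Distortions of Bob and Eve for the symmetric channel\<close>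

lemma nn_integral_distortion: "(\<integral>\<^sup>+\<omega>. ennreal ((Y \<omega> - X \<omega>)\<^sup>2) \<partial>J) = ennreal (\<tau>\<^sup>2)"
proof -
  have "(\<integral>\<^sup>+x. ennreal ((y - x)\<^sup>2) \<partial>gaussian y \<tau>) = ennreal (\<tau>\<^sup>2)" for y
    using nn_integral_gaussian_variance[OF \<tau>, of y] by (simp add: power2_commute)
  then show ?thesis
    using prob_space.emeasure_space_1[OF prob_space_\<nu>] by (subst nn_integral_J) simp_all
qed

lemma nn_integral_variance: "(\<integral>\<^sup>+\<omega>. ennreal ((X \<omega> - \<mu>)\<^sup>2) \<partial>J) = ennreal (\<sigma>\<^sup>2)"
  using nn_integral_gaussian_variance[OF \<sigma>, of \<mu>] unfolding distr_J_X[symmetric]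
  by (subst (asm) nn_integral_distr) auto

text \<open>Reflecting both X and Y about \<mu> preserves the law and leaves U unchanged, so z(U) is
  as far from X as from 2 \<mu> - X in mean square. By the parallelogram identity the two squared
  errors add up to 2 (X - \<mu>)^2 + 2 (z(U) - \<mu>)^2, whence each has mean at least the variance
  of X. The argument stays within [0, \<infinity>], so it also covers guesses with infinite
  error.\<close>

lemma nn_integral_guess_from_modulus_ge:
  assumes [measurable]: "z \<in> borel_measurable borel"
  shows "ennreal (\<sigma>\<^sup>2) \<le> (\<integral>\<^sup>+\<omega>. ennreal ((z (U \<omega>) - X \<omega>)\<^sup>2) \<partial>J)"
proof -
  let ?A = "\<integral>\<^sup>+\<omega>. ennreal ((z (U \<omega>) - X \<omega>)\<^sup>2) \<partial>J"
  let ?A' = "\<integral>\<^sup>+\<omega>. ennreal ((z (U \<omega>) - (2 * \<mu> - X \<omega>))\<^sup>2) \<partial>J"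
  let ?G = "\<lambda>y. \<integral>\<^sup>+x. ennreal ((z \<bar>y - \<mu>\<bar> - x)\<^sup>2) \<partial>gaussian y \<tau>"
  have Gm: "?G \<in> borel_measurable borel"
    by (rule measurable_nn_integral_gaussian) measurable
  have A: "?A = (\<integral>\<^sup>+y. ?G y \<partial>\<nu>)"
    by (subst nn_integral_J) auto
  have "?A' = (\<integral>\<^sup>+y. \<integral>\<^sup>+x. ennreal ((z \<bar>y - \<mu>\<bar> - (2 * \<mu> - x))\<^sup>2) \<partial>gaussian y \<tau> \<partial>\<nu>)"
    by (subst nn_integral_J) auto
  also have "\<dots> = (\<integral>\<^sup>+y. ?G (2 * \<mu> - y) \<partial>\<nu>)"
  proof (rule nn_integral_cong)
    fix y
    have "\<bar>2 * \<mu> - y - \<mu>\<bar> = \<bar>y - \<mu>\<bar>" by simp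
    then show "(\<integral>\<^sup>+x. ennreal ((z \<bar>y - \<mu>\<bar> - (2 * \<mu> - x))\<^sup>2) \<partial>gaussian y \<tau>) = ?G (2 * \<mu> - y)"
      using nn_integral_gaussian_reflect[OF \<tau>, where f = "\<lambda>x. ennreal ((z \<bar>y - \<mu>\<bar> - x)\<^sup>2)" and c = "2 * \<mu>" and y = y]
      by simp
  qed
  also have "\<dots> = ?A" unfolding A by (rule nn_integral_reflect_\<nu>[OF Gm])
  finally have A': "?A' = ?A" .
  have "2 * ennreal (\<sigma>\<^sup>2) = (\<integral>\<^sup>+\<omega>. 2 * ennreal ((X \<omega> - \<mu>)\<^sup>2) \<partial>J)"
    by (subst nn_integral_cmult) (simp_all add: nn_integral_variance)
  also have "\<dots> \<le> (\<integral>\<^sup>+\<omega>. ennreal ((z (U \<omega>) - X \<omega>)\<^sup>2) + ennreal ((z (U \<omega>) - (2 * \<mu> - X \<omega>))\<^sup>2) \<partial>J)"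
  proof (rule nn_integral_mono)
    fix \<omega>
    have "2 * (X \<omega> - \<mu>)\<^sup>2 \<le> 2 * (X \<omega> - \<mu>)\<^sup>2 + 2 * (z (U \<omega>) - \<mu>)\<^sup>2" by simp
    also have "\<dots> = (z (U \<omega>) - X \<omega>)\<^sup>2 + (z (U \<omega>) - (2 * \<mu> - X \<omega>))\<^sup>2"
      by (simp add: power2_eq_square algebra_simps)
    finally have "ennreal (2 * (X \<omega> - \<mu>)\<^sup>2)
        \<le> ennreal ((z (U \<omega>) - X \<omega>)\<^sup>2 + (z (U \<omega>) - (2 * \<mu> - X \<omega>))\<^sup>2)"
      by (rule ennreal_leI)
    then show "2 * ennreal ((X \<omega> - \<mu>)\<^sup>2)
        \<le> ennreal ((z (U \<omega>) - X \<omega>)\<^sup>2) + ennreal ((z (U \<omega>) - (2 * \<mu> - X \<omega>))\<^sup>2)"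
      by (simp add: ennreal_mult ennreal_plus)
  qed
  also have "\<dots> = ?A + ?A'"
    by (rule nn_integral_add) measurable
  also have "\<dots> = 2 * ?A" unfolding A' by (simp add: mult_2)
  finally show ?thesis
    by (subst (asm) ennreal_mult_le_mult_iff) auto
qed

lemma single_letter_value_ge: "ereal (1 - \<tau>\<^sup>2 / \<sigma>\<^sup>2) \<le> single_letter_value \<mu> \<sigma> p"
  unfolding single_letter_value_def
proof (rule INF_greatest)
  fix z :: "real \<Rightarrow> real" assume z[measurable]: "z \<in> borel \<rightarrow>\<^sub>M borel"
  let ?Z = "\<lambda>\<omega>. z (U \<omega>)"
  have eq: "(\<lambda>(x, y, u, v). payoff \<sigma> x y (z u)) = (\<lambda>\<omega>. payoff \<sigma> (X \<omega>) (Y \<omega>) (?Z \<omega>))"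
    by auto
  have "ereal (1 - \<tau>\<^sup>2 / \<sigma>\<^sup>2) \<le> ext_expectation J (\<lambda>\<omega>. payoff \<sigma> (X \<omega>) (Y \<omega>) (?Z \<omega>))"
  proof (cases "(\<integral>\<^sup>+\<omega>. ennreal ((?Z \<omega> - X \<omega>)\<^sup>2) \<partial>J) = \<infinity>")
    case True
    then show ?thesis
      using nn_integral_distortion
      by (subst ext_expectation_payoff_eq_PInf) (auto simp: \<sigma>)
  next
    case False
    then have iZ: "integrable J (\<lambda>\<omega>. (?Z \<omega> - X \<omega>)\<^sup>2)"
      by (intro integrableI_nonneg) (auto simp: less_top)
    have iY: "integrable J (\<lambda>\<omega>. (Y \<omega> - X \<omega>)\<^sup>2)"
      using nn_integral_distortion by (intro integrableI_nonneg) auto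
    have EY: "(\<integral>\<omega>. (Y \<omega> - X \<omega>)\<^sup>2 \<partial>J) = \<tau>\<^sup>2"
      using nn_integral_distortion by (subst integral_eq_nn_integral) auto
    have "ennreal (\<sigma>\<^sup>2) \<le> ennreal (\<integral>\<omega>. (?Z \<omega> - X \<omega>)\<^sup>2 \<partial>J)"
      using nn_integral_guess_from_modulus_ge[OF z] by (subst nn_integral_eq_integral[symmetric, OF iZ]) auto
    then have EZ: "\<sigma>\<^sup>2 \<le> (\<integral>\<omega>. (?Z \<omega> - X \<omega>)\<^sup>2 \<partial>J)" by (subst (asm) ennreal_le_iff) auto
    have "ext_expectation J (\<lambda>\<omega>. payoff \<sigma> (X \<omega>) (Y \<omega>) (?Z \<omega>))
        = ereal (((\<integral>\<omega>. (?Z \<omega> - X \<omega>)\<^sup>2 \<partial>J) - \<tau>\<^sup>2) / \<sigma>\<^sup>2)"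
      unfolding payoff_def using iZ iY EY by (subst ext_expectation_eq_integral) auto
    then show ?thesis
      using EZ \<sigma> divide_right_mono[of "\<sigma>\<^sup>2 - \<tau>\<^sup>2" "(\<integral>\<omega>. (?Z \<omega> - X \<omega>)\<^sup>2 \<partial>J) - \<tau>\<^sup>2" "\<sigma>\<^sup>2"]
      by (simp add: diff_divide_distrib)
  qed
  then show "ereal (1 - \<tau>\<^sup>2 / \<sigma>\<^sup>2) \<le> ext_expectation J (\<lambda>(x, y, u, v). payoff \<sigma> x y (z u))"
    unfolding eq .
qed

section \<open>Markov condition and key rate\<close>

text \<open>Y = V almost surely, so Y is deterministic given anything that determines V. Taking (U,
  V, X) and (U, V) for C gives kernels that depend on v only, as the Markov condition
  demands.\<close>

lemma regular_cond_law_Y_return_V: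
  assumes C[measurable]: "C \<in> J \<rightarrow>\<^sub>M T" and v[measurable]: "v \<in> T \<rightarrow>\<^sub>M borel"
    and vC: "\<And>\<omega>. v (C \<omega>) = V \<omega>"
  shows "regular_cond_law J borel T Y C (\<lambda>c. return borel (v c))"
proof (rule regular_cond_lawI[OF prob_space_J])
  show "(\<lambda>c. return borel (v c)) \<in> T \<rightarrow>\<^sub>M prob_algebra borel" by measurable
  show "C \<in> J \<rightarrow>\<^sub>M T" by fact
  show "Y \<in> J \<rightarrow>\<^sub>M borel" by measurable
  fix f :: "_ \<Rightarrow> ennreal" assume [measurable]: "f \<in> borel_measurable (T \<Otimes>\<^sub>M (borel :: real measure))"
  have "(\<integral>\<^sup>+\<omega>. f (C \<omega>, Y \<omega>) \<partial>J) = (\<integral>\<^sup>+\<omega>. f (C \<omega>, V \<omega>) \<partial>J)"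
    by (rule nn_integral_cong_AE) (use AE_J in \<open>auto elim!: eventually_mono\<close>)
  also have "\<dots> = (\<integral>\<^sup>+\<omega>. \<integral>\<^sup>+a. f (C \<omega>, a) \<partial>return borel (v (C \<omega>)) \<partial>J)"
  proof (rule nn_integral_cong)
    fix \<omega> assume "\<omega> \<in> space J"
    then have "C \<omega> \<in> space T" using measurable_space[OF C] by auto
    then have "(\<lambda>a. f (C \<omega>, a)) \<in> borel_measurable borel"
      by (intro measurable_compose[OF measurable_Pair1']) auto
    then show "f (C \<omega>, V \<omega>) = (\<integral>\<^sup>+a. f (C \<omega>, a) \<partial>return borel (v (C \<omega>)))"
      by (subst nn_integral_return) (auto simp: vC)
  qed
  finally show "(\<integral>\<^sup>+\<omega>. f (C \<omega>, Y \<omega>) \<partial>J) = (\<integral>\<^sup>+\<omega>. \<integral>\<^sup>+a. f (C \<omega>, a) \<partial>return borel (v (C \<omega>)) \<partial>J)" .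
qed

text \<open>The conditional law of ((X, Y), V) given U = u. The coin chooses between the two points
  at distance u from \<mu>; it is fair because \<nu> is symmetric about \<mu>. X is then drawn by
  the backward channel around the chosen point.\<close>

definition modulus_kernel :: "real \<Rightarrow> ((real \<times> real) \<times> real) measure" where
  "modulus_kernel u = measure_pmf (bernoulli_pmf (1 / 2)) \<bind> (\<lambda>b.
     let v = (if b then \<mu> + u else \<mu> - u)
     in distr (gaussian v \<tau>) ((borel \<Otimes>\<^sub>M borel) \<Otimes>\<^sub>M borel) (\<lambda>x. ((x, v), v)))"

lemma modulus_kernel_bind_measurable:
  "(\<lambda>(u, b). let v = (if b then \<mu> + u else \<mu> - u)
     in distr (gaussian v \<tau>) ((borel \<Otimes>\<^sub>M borel) \<Otimes>\<^sub>M borel) (\<lambda>x. ((x, v), v)))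
   \<in> borel \<Otimes>\<^sub>M count_space UNIV \<rightarrow>\<^sub>M prob_algebra ((borel \<Otimes>\<^sub>M borel) \<Otimes>\<^sub>M borel)"
proof -
  have v: "(\<lambda>(u, b). if b then \<mu> + u else \<mu> - u) \<in> borel \<Otimes>\<^sub>M count_space UNIV \<rightarrow>\<^sub>M borel"
    by measurable
  have "(\<lambda>v. distr (gaussian v \<tau>) ((borel \<Otimes>\<^sub>M borel) \<Otimes>\<^sub>M borel) (\<lambda>x. ((x, v), v)))
    \<in> borel \<rightarrow>\<^sub>M prob_algebra ((borel \<Otimes>\<^sub>M borel) \<Otimes>\<^sub>M borel)"
    by (rule measurable_distr_prob_space2[OF measurable_gaussian_mean[OF \<tau>]]) measurable
  from measurable_compose[OF v this] show ?thesis
    by (simp add: case_prod_unfold Let_def)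
qed

lemma modulus_kernel_measurable:
  "modulus_kernel \<in> borel \<rightarrow>\<^sub>M prob_algebra ((borel \<Otimes>\<^sub>M borel) \<Otimes>\<^sub>M borel)"
  unfolding modulus_kernel_def
  by (rule measurable_bind_prob_space2[OF measurable_const modulus_kernel_bind_measurable])
    (simp add: space_prob_algebra prob_space_measure_pmf)

lemma nn_integral_modulus_kernel:
  assumes f[measurable]: "f \<in> borel_measurable ((borel \<Otimes>\<^sub>M borel) \<Otimes>\<^sub>M borel)"
  shows "(\<integral>\<^sup>+a. f a \<partial>modulus_kernel u) =
    ennreal (1 / 2) * ((\<integral>\<^sup>+x. f ((x, \<mu> + u), \<mu> + u) \<partial>gaussian (\<mu> + u) \<tau>)
      + (\<integral>\<^sup>+x. f ((x, \<mu> - u), \<mu> - u) \<partial>gaussian (\<mu> - u) \<tau>))"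
proof -
  let ?K = "\<lambda>b. let v = (if b then \<mu> + u else \<mu> - u)
     in distr (gaussian v \<tau>) ((borel \<Otimes>\<^sub>M borel) \<Otimes>\<^sub>M borel) (\<lambda>x. ((x, v), v))"
  have "?K \<in> count_space UNIV \<rightarrow>\<^sub>M prob_algebra ((borel \<Otimes>\<^sub>M borel) \<Otimes>\<^sub>M borel)"
    using measurable_compose[OF measurable_Pair1'[of u borel "count_space UNIV"] modulus_kernel_bind_measurable]
    by simp
  then have K: "?K \<in> measure_pmf (bernoulli_pmf (1 / 2)) \<rightarrow>\<^sub>M subprob_algebra ((borel \<Otimes>\<^sub>M borel) \<Otimes>\<^sub>M borel)"
    by (intro measurable_prob_algebraD) simp
  show ?thesis
    unfolding modulus_kernel_def
    by (subst nn_integral_bind[OF f K])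
      (simp add: nn_integral_distr Let_def distrib_left mult.commute)
qed

text \<open>Applied at \<bar>y - \<mu>\<bar>, the kernel averages the integrand over y and its
  mirror image 2 \<mu> - y. Since \<nu> is invariant under this reflection, the averaging does not
  change the integral over \<nu>.\<close>

lemma regular_cond_law_modulus_kernel:
  "regular_cond_law J ((borel \<Otimes>\<^sub>M borel) \<Otimes>\<^sub>M borel) borel (\<lambda>\<omega>. ((X \<omega>, Y \<omega>), V \<omega>)) U modulus_kernel"
proof (rule regular_cond_lawI[OF prob_space_J _ _ modulus_kernel_measurable])
  show "(\<lambda>\<omega>. ((X \<omega>, Y \<omega>), V \<omega>)) \<in> J \<rightarrow>\<^sub>M (borel \<Otimes>\<^sub>M borel) \<Otimes>\<^sub>M borel" by measurable
  show "U \<in> J \<rightarrow>\<^sub>M borel" by measurable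
  fix f :: "real \<times> (real \<times> real) \<times> real \<Rightarrow> ennreal"
  assume f[measurable]: "f \<in> borel_measurable (borel \<Otimes>\<^sub>M (borel \<Otimes>\<^sub>M borel) \<Otimes>\<^sub>M (borel :: real measure))"
  let ?G = "\<lambda>y. \<integral>\<^sup>+x. f (\<bar>y - \<mu>\<bar>, (x, y), y) \<partial>gaussian y \<tau>"
  let ?H = "\<lambda>u. \<integral>\<^sup>+a. f (u, a) \<partial>modulus_kernel u"
  have Gm[measurable]: "?G \<in> borel_measurable borel"
    by (rule measurable_nn_integral_gaussian) measurable
  have Hm[measurable]: "?H \<in> borel_measurable borel"
    by (rule nn_integral_measurable_subprob_algebra2[OF _
          measurable_prob_algebraD[OF modulus_kernel_measurable]]) simp
  \<comment> \<open>The sign of y - \<mu> only decides which of the two branches of the kernel is y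
    and which is its mirror image; the sum is the same.\<close>
  have H: "?H \<bar>y - \<mu>\<bar> = ennreal (1 / 2) * (?G y + ?G (2 * \<mu> - y))" for y
  proof -
    have a: "\<bar>2 * \<mu> - y - \<mu>\<bar> = \<bar>y - \<mu>\<bar>" by simp
    have "(\<lambda>a. f (\<bar>y - \<mu>\<bar>, a)) \<in> borel_measurable ((borel \<Otimes>\<^sub>M borel) \<Otimes>\<^sub>M borel)" by measurable
    note K = nn_integral_modulus_kernel[OF this, of "\<bar>y - \<mu>\<bar>"]
    show ?thesis
    proof (cases "y \<ge> \<mu>")
      case True
      then have e: "\<mu> + \<bar>y - \<mu>\<bar> = y" "\<mu> - \<bar>y - \<mu>\<bar> = 2 * \<mu> - y" by auto
      show ?thesis by (simp only: K a e)
    next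
      case False
      then have e: "\<mu> + \<bar>y - \<mu>\<bar> = 2 * \<mu> - y" "\<mu> - \<bar>y - \<mu>\<bar> = y" by auto
      show ?thesis by (simp only: K a e add.commute)
    qed
  qed
  have "(\<integral>\<^sup>+\<omega>. ?H (U \<omega>) \<partial>J) = (\<integral>\<^sup>+y. ?H \<bar>y - \<mu>\<bar> \<partial>\<nu>)"
    by (subst nn_integral_J) (simp_all add: emeasure_gaussian_UNIV)
  also have "\<dots> = (\<integral>\<^sup>+y. ennreal (1 / 2) * (?G y + ?G (2 * \<mu> - y)) \<partial>\<nu>)"
    by (simp only: H)
  also have "\<dots> = ennreal (1 / 2) * ((\<integral>\<^sup>+y. ?G y \<partial>\<nu>) + (\<integral>\<^sup>+y. ?G (2 * \<mu> - y) \<partial>\<nu>))"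
    by (subst nn_integral_cmult, measurable, subst nn_integral_add) (use Gm in measurable)
  also have "(\<integral>\<^sup>+y. ?G (2 * \<mu> - y) \<partial>\<nu>) = (\<integral>\<^sup>+y. ?G y \<partial>\<nu>)"
    by (rule nn_integral_reflect_\<nu>[OF Gm])
  also have "ennreal (1 / 2) * ((\<integral>\<^sup>+y. ?G y \<partial>\<nu>) + (\<integral>\<^sup>+y. ?G y \<partial>\<nu>)) = (\<integral>\<^sup>+y. ?G y \<partial>\<nu>)"
  proof -
    have "ennreal (1 / 2) * (a + a) = a" for a
    proof -
      have "ennreal (1 / 2) * (a + a) = ennreal (1 / 2) * ennreal 2 * a" by (simp add: mult_2 mult.assoc)
      also have "ennreal (1 / 2) * ennreal 2 = 1" by (subst ennreal_mult[symmetric]) auto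
      finally show ?thesis by simp
    qed
    then show ?thesis .
  qed
  also have "\<dots> = (\<integral>\<^sup>+\<omega>. f (U \<omega>, (X \<omega>, Y \<omega>), V \<omega>) \<partial>J)"
    by (subst nn_integral_J) auto
  finally show "(\<integral>\<^sup>+\<omega>. f (U \<omega>, (X \<omega>, Y \<omega>), V \<omega>) \<partial>J) = (\<integral>\<^sup>+\<omega>. ?H (U \<omega>) \<partial>J)" ..
qed

text \<open>The kernel inside \<open>cond_mutual_info\<close> is an arbitrary choice among the
  conditional laws, so the bound is proved for any of them. The relation U = \<bar>V - \<mu>\<bar>
  is a property of \<open>J\<close> and passes to almost every conditional law: for almost every u,
  V takes only the values \<mu> + u and \<mu> - u. The bound for two-valued variables then applies
  pointwise in u.\<close>

lemma cond_mutual_info_le_1: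
  "cond_mutual_info J (borel \<Otimes>\<^sub>M borel) borel borel (\<lambda>\<omega>. (X \<omega>, Y \<omega>)) V U \<le> 1"
proof -
  let ?S = "(borel \<Otimes>\<^sub>M borel) \<Otimes>\<^sub>M borel :: ((real \<times> real) \<times> real) measure"
  define \<kappa> where "\<kappa> = (SOME \<kappa>. regular_cond_law J ?S borel (\<lambda>\<omega>. ((X \<omega>, Y \<omega>), V \<omega>)) U \<kappa>)"
  \<comment> \<open>\<open>modulus_kernel\<close> witnesses that a conditional law exists, so that
    the choice operator really returns one.\<close>
  have \<kappa>: "regular_cond_law J ?S borel (\<lambda>\<omega>. ((X \<omega>, Y \<omega>), V \<omega>)) U \<kappa>"
    unfolding \<kappa>_def by (rule someI[of _ modulus_kernel]) (rule regular_cond_law_modulus_kernel)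
  have \<kappa>m: "\<kappa> \<in> borel \<rightarrow>\<^sub>M prob_algebra ?S" using \<kappa> by (simp add: regular_cond_law_def)
  interpret J: prob_space J by (rule prob_space_J)
  define B where "B = {t :: real \<times> real. \<not> (snd t = \<mu> + fst t \<or> snd t = \<mu> - fst t)}"
  have [measurable]: "B \<in> sets (borel \<Otimes>\<^sub>M borel)"
  proof -
    have "B = {t \<in> space (borel \<Otimes>\<^sub>M borel). \<not> (snd t = \<mu> + fst t \<or> snd t = \<mu> - fst t)}"
      by (simp add: B_def space_pair_measure)
    also have "\<dots> \<in> sets (borel \<Otimes>\<^sub>M borel)" by measurable
    finally show ?thesis .
  qed
  let ?f = "\<lambda>(u, a). indicator B (u, snd a) :: ennreal"
  have fm[measurable]: "?f \<in> borel_measurable (borel \<Otimes>\<^sub>M ?S)" by measurable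
  have m: "(\<lambda>u. \<integral>\<^sup>+a. ?f (u, a) \<partial>\<kappa> u) \<in> borel_measurable borel"
    by (rule nn_integral_measurable_subprob_algebra2[OF _ measurable_prob_algebraD[OF \<kappa>m]]) measurable
  have "(\<integral>\<^sup>+u. \<integral>\<^sup>+a. ?f (u, a) \<partial>\<kappa> u \<partial>distr J borel U) = (\<integral>\<^sup>+\<omega>. \<integral>\<^sup>+a. ?f (U \<omega>, a) \<partial>\<kappa> (U \<omega>) \<partial>J)"
    by (subst nn_integral_distr) (use m in auto)
  also have "\<dots> = (\<integral>\<^sup>+\<omega>. ?f (U \<omega>, (X \<omega>, Y \<omega>), V \<omega>) \<partial>J)"
    by (rule nn_integral_regular_cond_law[OF \<kappa> prob_space_J _ _ fm, symmetric]) measurable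
  also have "\<dots> = (\<integral>\<^sup>+\<omega>. 0 \<partial>J)"
    by (rule nn_integral_cong_AE)
      (use AE_J in \<open>auto elim!: eventually_mono simp: B_def indicator_def\<close>)
  finally have "AE u in distr J borel U. (\<integral>\<^sup>+a. ?f (u, a) \<partial>\<kappa> u) = 0"
    using nn_integral_0_iff_AE[of "\<lambda>u. \<integral>\<^sup>+a. ?f (u, a) \<partial>\<kappa> u" "distr J borel U"] m by simp
  then have "AE u in distr J borel U. mutual_info (\<kappa> u) (borel \<Otimes>\<^sub>M borel) borel fst snd \<le> 1"
  proof eventually_elim
    case (elim u)
    have k: "prob_space (\<kappa> u)" "sets (\<kappa> u) = sets ?S"
      using measurable_space[OF \<kappa>m, of u] by (auto simp: space_prob_algebra)
    have "(\<lambda>a. ?f (u, a)) \<in> borel_measurable ?S" by measurable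
    then have "(\<lambda>a. ?f (u, a)) \<in> borel_measurable (\<kappa> u)"
      using measurable_cong_sets[OF k(2) refl] by blast
    then have "AE a in \<kappa> u. ?f (u, a) = 0"
      using elim nn_integral_0_iff_AE by blast
    then show ?case
      by (intro mutual_info_two_valued_le_1[where a = "\<mu> + u" and b = "\<mu> - u"] k)
        (auto elim!: eventually_mono simp: B_def indicator_def split: if_splits)
  qed
  then have "(\<integral>\<^sup>+u. mutual_info (\<kappa> u) (borel \<Otimes>\<^sub>M borel) borel fst snd \<partial>distr J borel U)
      \<le> (\<integral>\<^sup>+u. 1 \<partial>distr J borel U)"
    by (rule nn_integral_mono_AE)
  also have "\<dots> = 1"
    using prob_space.emeasure_space_1[OF J.prob_space_distr, of U borel] by simp
  finally show ?thesis
    unfolding cond_mutual_info_def \<kappa>_def[symmetric] Let_def .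
qed

section \<open>Communication rate\<close>

text \<open>Fix w = (u, v) and integrate over x: the source density times the ratio is the density
  of \<open>gaussian v \<tau>\<close>, the backward channel from V = Y. The law of W is kept as a
  measure throughout, so this holds for a point mass \<nu> as well.\<close>

lemma density_product_eq_joint:
  "density (distr J borel X \<Otimes>\<^sub>M distr J (borel \<Otimes>\<^sub>M borel) (\<lambda>\<omega>. (U \<omega>, V \<omega>)))
     (\<lambda>(x, w). ennreal (exp (ln (\<sigma> / \<tau>) - (snd w - x)\<^sup>2 / (2 * \<tau>\<^sup>2) + (x - \<mu>)\<^sup>2 / (2 * \<sigma>\<^sup>2))))
   = distr J (borel \<Otimes>\<^sub>M borel \<Otimes>\<^sub>M borel) (\<lambda>\<omega>. (X \<omega>, U \<omega>, V \<omega>))"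
proof (rule measure_eqI)
  let ?T = "borel \<Otimes>\<^sub>M borel :: (real \<times> real) measure"
  let ?W = "\<lambda>\<omega>. (U \<omega>, V \<omega>)"
  let ?Q = "distr J borel X \<Otimes>\<^sub>M distr J ?T ?W"
  let ?r = "\<lambda>(x, w :: real \<times> real). ennreal (exp (ln (\<sigma> / \<tau>) - (snd w - x)\<^sup>2 / (2 * \<tau>\<^sup>2) + (x - \<mu>)\<^sup>2 / (2 * \<sigma>\<^sup>2)))"
  interpret J: prob_space J by (rule prob_space_J)
  have Wm[measurable]: "?W \<in> J \<rightarrow>\<^sub>M ?T" by measurable
  interpret PX: prob_space "distr J borel X" by (rule J.prob_space_distr) measurable
  interpret PW: prob_space "distr J ?T ?W" by (rule J.prob_space_distr) measurable
  interpret XW: pair_prob_space "distr J borel X" "distr J ?T ?W" ..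
  have sQ[measurable_cong]: "sets ?Q = sets (borel \<Otimes>\<^sub>M ?T)"
    by (rule sets_pair_measure_cong) simp_all
  show "sets (density ?Q ?r) = sets (distr J (borel \<Otimes>\<^sub>M ?T) (\<lambda>\<omega>. (X \<omega>, U \<omega>, V \<omega>)))"
    by (simp add: sQ)
  fix E assume "E \<in> sets (density ?Q ?r)"
  then have E[measurable]: "E \<in> sets (borel \<Otimes>\<^sub>M ?T)" by (simp add: sQ)
  have rm[measurable]: "?r \<in> borel_measurable (borel \<Otimes>\<^sub>M ?T)" by measurable
  have EQ: "E \<in> sets ?Q" using E by (simp add: sQ)
  have rQ: "?r \<in> borel_measurable ?Q" using rm measurable_cong_sets[OF sQ refl] by blast
  have rEQ: "(\<lambda>t. ?r t * indicator E t) \<in> borel_measurable ?Q"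
    by (intro borel_measurable_times_ennreal borel_measurable_indicator rQ EQ)
  let ?g = "\<lambda>w. \<integral>\<^sup>+x. indicator E (x, w) \<partial>gaussian (snd w) \<tau>"
  have gm: "?g \<in> borel_measurable ?T"
    by (rule nn_integral_measurable_subprob_algebra2[OF _ measurable_prob_algebraD[OF
            measurable_compose[OF measurable_snd measurable_gaussian_mean[OF \<tau>]]]]) measurable
  have inner: "(\<integral>\<^sup>+x. ?r (x, w) * indicator E (x, w) \<partial>distr J borel X) = ?g w" for w
  proof -
    have Pw: "(\<lambda>x. (x, w)) \<in> borel \<rightarrow>\<^sub>M borel \<Otimes>\<^sub>M ?T"
      by (rule measurable_Pair2') (simp add: space_pair_measure)
    have Ew: "(\<lambda>x. indicator E (x, w) :: ennreal) \<in> borel_measurable borel"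
      by (rule measurable_compose[OF Pw borel_measurable_indicator[OF E]])
    have rw: "(\<lambda>x. ?r (x, w)) \<in> borel_measurable borel"
      by (rule measurable_compose[OF Pw rm])
    have "(\<integral>\<^sup>+x. ?r (x, w) * indicator E (x, w) \<partial>distr J borel X) =
      (\<integral>\<^sup>+x. ennreal (normal_density \<mu> \<sigma> x) * (?r (x, w) * indicator E (x, w)) \<partial>lborel)"
      unfolding distr_J_X by (intro nn_integral_gaussian borel_measurable_times_ennreal rw Ew)
    also have "\<dots> = (\<integral>\<^sup>+x. ennreal (normal_density (snd w) \<tau> x) * indicator E (x, w) \<partial>lborel)"
      by (simp add: mult.assoc[symmetric] ennreal_mult'[symmetric] normal_density_ratio[OF \<sigma> \<tau>])
    also have "\<dots> = ?g w" by (rule nn_integral_gaussian[OF Ew, symmetric])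
    finally show ?thesis .
  qed
  have "emeasure (density ?Q ?r) E = (\<integral>\<^sup>+t. ?r t * indicator E t \<partial>?Q)"
    by (rule emeasure_density[OF rQ EQ])
  also have "\<dots> = (\<integral>\<^sup>+w. \<integral>\<^sup>+x. ?r (x, w) * indicator E (x, w) \<partial>distr J borel X \<partial>distr J ?T ?W)"
    by (rule XW.nn_integral_snd[OF rEQ, symmetric])
  also have "\<dots> = (\<integral>\<^sup>+w. ?g w \<partial>distr J ?T ?W)" by (simp only: inner)
  also have "\<dots> = (\<integral>\<^sup>+\<omega>. ?g (?W \<omega>) \<partial>J)"
    by (rule nn_integral_distr[OF Wm]) (use gm in simp)
  also have "\<dots> = (\<integral>\<^sup>+y. ?g (\<bar>y - \<mu>\<bar>, y) \<partial>\<nu>)"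
  proof -
    have "(\<lambda>\<omega>. ?g (?W \<omega>)) \<in> borel_measurable (borel \<Otimes>\<^sub>M borel \<Otimes>\<^sub>M borel \<Otimes>\<^sub>M borel)"
      by (rule measurable_compose[OF _ gm]) measurable
    from nn_integral_J[OF this] show ?thesis by (simp add: emeasure_gaussian_UNIV)
  qed
  also have "\<dots> = (\<integral>\<^sup>+\<omega>. indicator E (X \<omega>, U \<omega>, V \<omega>) \<partial>J)"
    by (subst nn_integral_J) auto
  also have "\<dots> = (\<integral>\<^sup>+t. indicator E t \<partial>distr J (borel \<Otimes>\<^sub>M ?T) (\<lambda>\<omega>. (X \<omega>, U \<omega>, V \<omega>)))"
    by (subst nn_integral_distr) auto
  also have "\<dots> = emeasure (distr J (borel \<Otimes>\<^sub>M ?T) (\<lambda>\<omega>. (X \<omega>, U \<omega>, V \<omega>))) E"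
    by simp
  finally show "emeasure (density ?Q ?r) E = emeasure (distr J (borel \<Otimes>\<^sub>M ?T) (\<lambda>\<omega>. (X \<omega>, U \<omega>, V \<omega>))) E" .
qed

text \<open>In the expected log-likelihood ratio both quadratic terms have mean 1/2, because V - X
  has second moment \<tau>^2 and X has variance \<sigma>^2. They cancel, and the constant term is
  left.\<close>

lemma mutual_info_X_UV:
  "mutual_info J borel (borel \<Otimes>\<^sub>M borel) X (\<lambda>\<omega>. (U \<omega>, V \<omega>)) = ennreal (log 2 (\<sigma> / \<tau>))"
proof -
  let ?T = "borel \<Otimes>\<^sub>M borel :: (real \<times> real) measure"
  let ?W = "\<lambda>\<omega>. (U \<omega>, V \<omega>)"
  let ?N = "distr J (borel \<Otimes>\<^sub>M ?T) (\<lambda>\<omega>. (X \<omega>, ?W \<omega>))"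
  let ?Q = "distr J borel X \<Otimes>\<^sub>M distr J ?T ?W"
  define r where "r = (\<lambda>(x, w :: real \<times> real).
    exp (ln (\<sigma> / \<tau>) - (snd w - x)\<^sup>2 / (2 * \<tau>\<^sup>2) + (x - \<mu>)\<^sup>2 / (2 * \<sigma>\<^sup>2)))"
  interpret J: prob_space J by (rule prob_space_J)
  have sQ: "sets ?Q = sets (borel \<Otimes>\<^sub>M ?T)"
    by (rule sets_pair_measure_cong) simp_all
  have XWm[measurable]: "(\<lambda>\<omega>. (X \<omega>, ?W \<omega>)) \<in> J \<rightarrow>\<^sub>M borel \<Otimes>\<^sub>M ?T" by measurable
  have rm[measurable]: "r \<in> borel_measurable (borel \<Otimes>\<^sub>M ?T)" unfolding r_def by measurable
  have rQ: "r \<in> borel_measurable ?Q" using rm measurable_cong_sets[OF sQ refl] by blast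
  have N: "density ?Q (\<lambda>t. ennreal (r t)) = ?N"
    using density_product_eq_joint by (simp add: r_def case_prod_unfold)
  have pos: "r t > 0" for t by (simp add: r_def case_prod_unfold)
  have lr: "log 2 (r (X \<omega>, ?W \<omega>)) =
      (ln (\<sigma> / \<tau>) - (V \<omega> - X \<omega>)\<^sup>2 / (2 * \<tau>\<^sup>2) + (X \<omega> - \<mu>)\<^sup>2 / (2 * \<sigma>\<^sup>2)) / ln 2" for \<omega>
    by (simp add: r_def log_def)
  have D: "(\<integral>\<^sup>+\<omega>. ennreal ((V \<omega> - X \<omega>)\<^sup>2) \<partial>J) = ennreal (\<tau>\<^sup>2)"
    unfolding nn_integral_distortion[symmetric]
    by (rule nn_integral_cong_AE) (use AE_J in \<open>auto elim!: eventually_mono\<close>)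
  have iD: "integrable J (\<lambda>\<omega>. (V \<omega> - X \<omega>)\<^sup>2)" and ED: "(\<integral>\<omega>. (V \<omega> - X \<omega>)\<^sup>2 \<partial>J) = \<tau>\<^sup>2"
    using D by (auto intro!: integrableI_nonneg simp: integral_eq_nn_integral)
  have iX: "integrable J (\<lambda>\<omega>. (X \<omega> - \<mu>)\<^sup>2)" and EX: "(\<integral>\<omega>. (X \<omega> - \<mu>)\<^sup>2 \<partial>J) = \<sigma>\<^sup>2"
    using nn_integral_variance by (auto intro!: integrableI_nonneg simp: integral_eq_nn_integral)
  have lm: "(\<lambda>t. log 2 (r t)) \<in> borel_measurable (borel \<Otimes>\<^sub>M ?T)"
    unfolding log_def by (intro borel_measurable_divide borel_measurable_ln rm borel_measurable_const)
  have int: "integrable ?N (\<lambda>t. log 2 (r t))"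
    unfolding integrable_distr_eq[OF XWm lm] lr using iD iX by auto
  have "(\<integral>t. log 2 (r t) \<partial>?N) = (ln (\<sigma> / \<tau>) - \<tau>\<^sup>2 / (2 * \<tau>\<^sup>2) + \<sigma>\<^sup>2 / (2 * \<sigma>\<^sup>2)) / ln 2"
    unfolding integral_distr[OF XWm lm] lr using iD iX ED EX by (simp add: J.prob_space)
  also have "\<dots> = log 2 (\<sigma> / \<tau>)" using \<sigma> \<tau> by (simp add: log_def)
  finally have E: "(\<integral>t. log 2 (r t) \<partial>?N) = log 2 (\<sigma> / \<tau>)" .
  have "prob_space ?Q"
    by (intro prob_space_pair J.prob_space_distr) measurable
  moreover have "prob_space ?N" by (rule J.prob_space_distr) measurable
  ultimately have "rel_entropy ?N ?Q = ennreal (\<integral>t. log 2 (r t) \<partial>?N)"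
    using rel_entropy_density[of ?Q r] rQ pos int unfolding N by blast
  then show ?thesis unfolding mutual_info_def E .
qed

lemma channel_admissible:
  assumes "log 2 (\<sigma> / \<tau>) \<le> R" "1 \<le> Rs"
  shows "p \<in> admissible \<mu> \<sigma> R Rs"
proof -
  have "regular_cond_law J borel (borel \<Otimes>\<^sub>M borel \<Otimes>\<^sub>M borel) Y (\<lambda>\<omega>. (U \<omega>, V \<omega>, X \<omega>))
      (\<lambda>c. return borel (fst (snd c)))"
    by (rule regular_cond_law_Y_return_V) auto
  moreover have "regular_cond_law J borel (borel \<Otimes>\<^sub>M borel) Y (\<lambda>\<omega>. (U \<omega>, V \<omega>)) (\<lambda>c. return borel (snd c))"
    by (rule regular_cond_law_Y_return_V) auto
  moreover have "cond_mutual_info J (borel \<Otimes>\<^sub>M borel) borel borel (\<lambda>\<omega>. (X \<omega>, Y \<omega>)) V U \<le> ennreal Rs"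
    using cond_mutual_info_le_1 ennreal_leI[OF assms(2)] by (auto intro: order_trans)
  moreover have "mutual_info J borel (borel \<Otimes>\<^sub>M borel) X (\<lambda>\<omega>. (U \<omega>, V \<omega>)) \<le> ennreal R"
    unfolding mutual_info_X_UV by (rule ennreal_leI) fact
  \<comment> \<open>Both kernels above are point masses at v, so the single kernel
    \<open>\<lambda>c. return borel (snd c)\<close> serves as q in both conditional laws.\<close>
  ultimately show ?thesis
    unfolding admissible_def Let_def using p
    by (auto simp: case_prod_unfold intro!: exI[of _ "\<lambda>c. return borel (snd c)"])
qed

end

section \<open>Existence of the test channel\<close>

text \<open>Bayes' rule for the additive model X = Y + noise with variances s^2 and \<tau>^2. The
  coefficient s^2 / \<sigma>^2 is that of the linear regression of Y on X, and (s \<tau> /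
  \<sigma>)^2 = s^2 - s^4 / \<sigma>^2 is the residual variance.\<close>

lemma normal_density_exchange:
  assumes "s > 0" "\<tau> > 0" "\<sigma> > 0" and \<sigma>: "\<sigma>\<^sup>2 = s\<^sup>2 + \<tau>\<^sup>2"
  shows "normal_density \<mu> \<sigma> x * normal_density (\<mu> + s\<^sup>2 / \<sigma>\<^sup>2 * (x - \<mu>)) (s * \<tau> / \<sigma>) y
    = normal_density \<mu> s y * normal_density y \<tau> x"
proof -
  define a b where "a = x - \<mu>" and "b = y - \<mu>"
  have e: "(x - \<mu>)\<^sup>2 / (2 * \<sigma>\<^sup>2) + (y - (\<mu> + s\<^sup>2 / \<sigma>\<^sup>2 * (x - \<mu>)))\<^sup>2 / (2 * (s * \<tau> / \<sigma>)\<^sup>2)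
     = (y - \<mu>)\<^sup>2 / (2 * s\<^sup>2) + (x - y)\<^sup>2 / (2 * \<tau>\<^sup>2)"
  proof -
    have "y - (\<mu> + s\<^sup>2 / \<sigma>\<^sup>2 * (x - \<mu>)) = (b * \<sigma>\<^sup>2 - s\<^sup>2 * a) / \<sigma>\<^sup>2"
      using assms by (simp add: a_def b_def field_simps)
    moreover have "x - y = a - b" by (simp add: a_def b_def)
    moreover have "a\<^sup>2 / (2 * \<sigma>\<^sup>2) + ((b * \<sigma>\<^sup>2 - s\<^sup>2 * a) / \<sigma>\<^sup>2)\<^sup>2 / (2 * (s * \<tau> / \<sigma>)\<^sup>2)
      = b\<^sup>2 / (2 * s\<^sup>2) + (a - b)\<^sup>2 / (2 * \<tau>\<^sup>2)"
    proof -
      \<comment> \<open>In terms of the variances, with \<sigma>^2 = S + T, completing the square is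
        an identity of rational functions.\<close>
      define S T where "S = s\<^sup>2" and "T = \<tau>\<^sup>2"
      have ST: "S > 0" "T > 0" using assms by (auto simp: S_def T_def)
      have "a\<^sup>2 / (2 * (S + T)) + (b * (S + T) - S * a)\<^sup>2 / (S + T)\<^sup>2 / (2 * (S * T / (S + T)))
        = b\<^sup>2 / (2 * S) + (a - b)\<^sup>2 / (2 * T)"
        using ST by (simp add: divide_simps) (simp add: power2_eq_square algebra_simps)
      then show ?thesis
        using \<sigma> by (simp add: power_divide power_mult_distrib S_def T_def)
    qed
    ultimately show ?thesis by (simp add: a_def[symmetric] b_def[symmetric])
  qed
  have q: "sqrt (2 * pi * \<sigma>\<^sup>2) * sqrt (2 * pi * (s * \<tau> / \<sigma>)\<^sup>2) = sqrt (2 * pi * s\<^sup>2) * sqrt (2 * pi * \<tau>\<^sup>2)"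
    using assms(1-3) by (simp add: real_sqrt_mult)
  have gen: "1 / k * A * (1 / l * B) = 1 / m * C * (1 / n * D)"
    if "A * B = C * D" "k * l = m * n" for A B C D k l m n :: real
  proof -
    have "1 / k * A * (1 / l * B) = A * B / (k * l)" by simp
    also have "\<dots> = 1 / m * C * (1 / n * D)" by (simp add: that)
    finally show ?thesis .
  qed
  have "exp (- (x - \<mu>)\<^sup>2 / (2 * \<sigma>\<^sup>2)) * exp (- (y - (\<mu> + s\<^sup>2 / \<sigma>\<^sup>2 * (x - \<mu>)))\<^sup>2 / (2 * (s * \<tau> / \<sigma>)\<^sup>2))
     = exp (- (y - \<mu>)\<^sup>2 / (2 * s\<^sup>2)) * exp (- (x - y)\<^sup>2 / (2 * \<tau>\<^sup>2))"
    unfolding exp_add[symmetric] using e by simp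
  then show ?thesis
    unfolding normal_density_def by (intro gen q)
qed

text \<open>\<open>joint_law\<close> requires the forward kernel from x, whereas the locale
  describes the law from Y backwards. Exchanging the densities under the double integral and then
  the order of integration passes from one to the other.\<close>

lemma gaussian_test_channel:
  assumes s: "s > 0" and \<tau>: "\<tau> > 0" and \<sigma>: "\<sigma> > 0" and eq: "\<sigma>\<^sup>2 = s\<^sup>2 + \<tau>\<^sup>2"
  shows "symmetric_backward_channel \<mu> \<sigma> \<tau>
    (\<lambda>x. distr (gaussian (\<mu> + s\<^sup>2 / \<sigma>\<^sup>2 * (x - \<mu>)) (s * \<tau> / \<sigma>)) (borel \<Otimes>\<^sub>M borel \<Otimes>\<^sub>M borel)
       (\<lambda>y. (y, \<bar>y - \<mu>\<bar>, y))) (gaussian \<mu> s)"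
proof
  let ?m = "\<lambda>x. \<mu> + s\<^sup>2 / \<sigma>\<^sup>2 * (x - \<mu>)"
  let ?p = "\<lambda>x. distr (gaussian (?m x) (s * \<tau> / \<sigma>)) (borel \<Otimes>\<^sub>M borel \<Otimes>\<^sub>M borel)
       (\<lambda>y. (y, \<bar>y - \<mu>\<bar>, y))"
  have st: "s * \<tau> / \<sigma> > 0" using s \<tau> \<sigma> by simp
  have K: "(\<lambda>x. gaussian (?m x) (s * \<tau> / \<sigma>)) \<in> borel \<rightarrow>\<^sub>M prob_algebra borel"
    by (rule measurable_compose[OF _ measurable_gaussian_mean[OF st]]) measurable
  show p: "?p \<in> borel \<rightarrow>\<^sub>M prob_algebra (borel \<Otimes>\<^sub>M borel \<Otimes>\<^sub>M borel)"
    by (rule measurable_distr_prob_space2[OF K]) measurable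
  show "\<sigma> > 0" "\<tau> > 0" by fact+
  show "gaussian \<mu> s \<in> space (prob_algebra borel)" by (rule gaussian_in_prob_algebra[OF s])
  show "distr (gaussian \<mu> s) borel (\<lambda>y. 2 * \<mu> - y) = gaussian \<mu> s"
  proof (rule measure_eqI)
    fix E assume "E \<in> sets (distr (gaussian \<mu> s) borel (\<lambda>y. 2 * \<mu> - y))"
    then have E: "E \<in> sets borel" by simp
    then have "emeasure (distr (gaussian \<mu> s) borel (\<lambda>y. 2 * \<mu> - y)) E
      = (\<integral>\<^sup>+x. indicator E x \<partial>distr (gaussian \<mu> s) borel (\<lambda>y. 2 * \<mu> - y))" by simp
    also have "\<dots> = (\<integral>\<^sup>+y. indicator E (2 * \<mu> - y) \<partial>gaussian \<mu> s)"
      using E by (subst nn_integral_distr) auto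
    also have "\<dots> = emeasure (gaussian \<mu> s) E"
      using E nn_integral_gaussian_reflect[OF s, where f = "indicator E" and c = "2 * \<mu>" and y = \<mu>] by simp
    finally show "emeasure (distr (gaussian \<mu> s) borel (\<lambda>y. 2 * \<mu> - y)) E = emeasure (gaussian \<mu> s) E" .
  qed simp
  fix f :: "real \<times> real \<times> real \<times> real \<Rightarrow> ennreal"
  assume f[measurable]: "f \<in> borel_measurable (borel \<Otimes>\<^sub>M borel \<Otimes>\<^sub>M borel \<Otimes>\<^sub>M borel)"
  define g where "g = (\<lambda>(x, y). f (x, y, \<bar>y - \<mu>\<bar>, y))"
  have g[measurable]: "g \<in> borel_measurable (borel \<Otimes>\<^sub>M borel)"
    unfolding g_def by measurable
  have gx: "(\<lambda>y. g (x, y)) \<in> borel_measurable borel" for x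
    by (rule measurable_compose[OF measurable_Pair1' g]) simp
  have gy: "(\<lambda>x. g (x, y)) \<in> borel_measurable borel" for y
    by (rule measurable_compose[OF measurable_Pair2' g]) simp
  have "(\<integral>\<^sup>+\<omega>. f \<omega> \<partial>joint_law \<mu> \<sigma> ?p) = (\<integral>\<^sup>+x. \<integral>\<^sup>+y. g (x, y) \<partial>gaussian (?m x) (s * \<tau> / \<sigma>) \<partial>gaussian \<mu> \<sigma>)"
    by (subst nn_integral_joint_law[OF \<sigma> p f]) (simp add: nn_integral_distr g_def)
  also have "\<dots> = (\<integral>\<^sup>+x. ennreal (normal_density \<mu> \<sigma> x) *
      (\<integral>\<^sup>+y. g (x, y) \<partial>gaussian (?m x) (s * \<tau> / \<sigma>)) \<partial>lborel)"
    by (rule nn_integral_gaussian, rule nn_integral_measurable_subprob_algebra2[OF _ measurable_prob_algebraD[OF K]])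
      simp
  also have "\<dots> = (\<integral>\<^sup>+x. \<integral>\<^sup>+y. ennreal (normal_density \<mu> s y * normal_density y \<tau> x) * g (x, y) \<partial>lborel \<partial>lborel)"
  proof (rule nn_integral_cong)
    fix x
    have "ennreal (normal_density \<mu> \<sigma> x) * (\<integral>\<^sup>+y. g (x, y) \<partial>gaussian (?m x) (s * \<tau> / \<sigma>))
      = ennreal (normal_density \<mu> \<sigma> x) *
        (\<integral>\<^sup>+y. ennreal (normal_density (?m x) (s * \<tau> / \<sigma>) y) * g (x, y) \<partial>lborel)"
      by (simp only: nn_integral_gaussian[OF gx])
    also have "\<dots> = (\<integral>\<^sup>+y. ennreal (normal_density \<mu> \<sigma> x) *
        (ennreal (normal_density (?m x) (s * \<tau> / \<sigma>) y) * g (x, y)) \<partial>lborel)"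
      using gx[of x] by (intro nn_integral_cmult[symmetric]) simp
    also have "\<dots> = (\<integral>\<^sup>+y. ennreal (normal_density \<mu> \<sigma> x * normal_density (?m x) (s * \<tau> / \<sigma>) y) * g (x, y) \<partial>lborel)"
      by (simp add: ennreal_mult mult.assoc)
    finally show "ennreal (normal_density \<mu> \<sigma> x) * (\<integral>\<^sup>+y. g (x, y) \<partial>gaussian (?m x) (s * \<tau> / \<sigma>))
      = (\<integral>\<^sup>+y. ennreal (normal_density \<mu> s y * normal_density y \<tau> x) * g (x, y) \<partial>lborel)"
      by (simp only: normal_density_exchange[OF s \<tau> \<sigma> eq])
  qed
  also have "\<dots> = (\<integral>\<^sup>+y. \<integral>\<^sup>+x. ennreal (normal_density \<mu> s y * normal_density y \<tau> x) * g (x, y) \<partial>lborel \<partial>lborel)"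
  proof (rule lborel_pair.Fubini'[symmetric])
    have "(\<lambda>(x, y). ennreal (normal_density \<mu> s y * normal_density y \<tau> x) * g (x, y)) \<in> borel_measurable (borel \<Otimes>\<^sub>M borel)"
      unfolding normal_density_def by measurable
    then show "(\<lambda>(x, y). ennreal (normal_density \<mu> s y * normal_density y \<tau> x) * g (x, y)) \<in> borel_measurable (lborel \<Otimes>\<^sub>M lborel)"
      by simp
  qed
  also have "\<dots> = (\<integral>\<^sup>+y. ennreal (normal_density \<mu> s y) * (\<integral>\<^sup>+x. g (x, y) \<partial>gaussian y \<tau>) \<partial>lborel)"
  proof (rule nn_integral_cong)
    fix y
    have "(\<integral>\<^sup>+x. ennreal (normal_density \<mu> s y * normal_density y \<tau> x) * g (x, y) \<partial>lborel)
      = (\<integral>\<^sup>+x. ennreal (normal_density \<mu> s y) * (ennreal (normal_density y \<tau> x) * g (x, y)) \<partial>lborel)"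
      by (simp add: ennreal_mult mult.assoc)
    also have "\<dots> = ennreal (normal_density \<mu> s y) * (\<integral>\<^sup>+x. ennreal (normal_density y \<tau> x) * g (x, y) \<partial>lborel)"
      using gy[of y] by (intro nn_integral_cmult) simp
    also have "\<dots> = ennreal (normal_density \<mu> s y) * (\<integral>\<^sup>+x. g (x, y) \<partial>gaussian y \<tau>)"
      by (simp only: nn_integral_gaussian[OF gy])
    finally show "(\<integral>\<^sup>+x. ennreal (normal_density \<mu> s y * normal_density y \<tau> x) * g (x, y) \<partial>lborel)
      = ennreal (normal_density \<mu> s y) * (\<integral>\<^sup>+x. g (x, y) \<partial>gaussian y \<tau>)" .
  qed
  also have "\<dots> = (\<integral>\<^sup>+y. \<integral>\<^sup>+x. g (x, y) \<partial>gaussian y \<tau> \<partial>gaussian \<mu> s)"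
    by (rule nn_integral_gaussian[symmetric], rule nn_integral_measurable_subprob_algebra2[OF _
          measurable_prob_algebraD[OF measurable_gaussian_mean[OF \<tau>]]]) measurable
  finally show "(\<integral>\<^sup>+\<omega>. f \<omega> \<partial>joint_law \<mu> \<sigma> ?p)
    = (\<integral>\<^sup>+y. \<integral>\<^sup>+x. f (x, y, \<bar>y - \<mu>\<bar>, y) \<partial>gaussian y \<tau> \<partial>gaussian \<mu> s)"
    by (simp add: g_def)
qed

text \<open>At R = 0 the parameters degenerate to \<tau> = \<sigma> and s = 0, where
  \<open>gaussian \<mu> s\<close> no longer represents the law of Y. Bob then outputs the mean, and
  the modulus is 0.\<close>

lemma constant_test_channel:
  assumes \<sigma>: "\<sigma> > 0"
  shows "symmetric_backward_channel \<mu> \<sigma> \<sigma>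
    (\<lambda>x. return (borel \<Otimes>\<^sub>M borel \<Otimes>\<^sub>M borel) (\<mu>, 0, \<mu>)) (return borel \<mu>)"
proof (rule symmetric_backward_channel.intro[OF \<sigma> \<sigma>])
  let ?p = "\<lambda>x :: real. return (borel \<Otimes>\<^sub>M borel \<Otimes>\<^sub>M borel) (\<mu>, 0, \<mu>)"
  show p: "?p \<in> borel \<rightarrow>\<^sub>M prob_algebra (borel \<Otimes>\<^sub>M borel \<Otimes>\<^sub>M borel)" by measurable
  show "return borel \<mu> \<in> space (prob_algebra borel)"
    by (simp add: space_prob_algebra prob_space_return)
  show "distr (return borel \<mu>) borel (\<lambda>y. 2 * \<mu> - y) = return borel \<mu>"
    by (subst distr_return) auto
  fix f :: "real \<times> real \<times> real \<times> real \<Rightarrow> ennreal"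
  assume f[measurable]: "f \<in> borel_measurable (borel \<Otimes>\<^sub>M borel \<Otimes>\<^sub>M borel \<Otimes>\<^sub>M borel)"
  have fx: "(\<lambda>a. f (x, a)) \<in> borel_measurable (borel \<Otimes>\<^sub>M borel \<Otimes>\<^sub>M borel)" for x
    by (rule measurable_compose[OF measurable_Pair1' f]) simp
  have m: "(\<lambda>y. \<integral>\<^sup>+x. f (x, y, \<bar>y - \<mu>\<bar>, y) \<partial>gaussian y \<sigma>) \<in> borel_measurable borel"
    by (rule nn_integral_measurable_subprob_algebra2[OF _
          measurable_prob_algebraD[OF measurable_gaussian_mean[OF \<sigma>]]]) measurable
  have "(\<integral>\<^sup>+\<omega>. f \<omega> \<partial>joint_law \<mu> \<sigma> ?p) = (\<integral>\<^sup>+x. f (x, \<mu>, 0, \<mu>) \<partial>gaussian \<mu> \<sigma>)"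
    by (subst nn_integral_joint_law[OF \<sigma> p f]) (simp add: nn_integral_return[OF _ fx] space_pair_measure)
  then show "(\<integral>\<^sup>+\<omega>. f \<omega> \<partial>joint_law \<mu> \<sigma> ?p)
    = (\<integral>\<^sup>+y. \<integral>\<^sup>+x. f (x, y, \<bar>y - \<mu>\<bar>, y) \<partial>gaussian y \<sigma> \<partial>return borel \<mu>)"
    by (subst nn_integral_return[OF _ m]) simp_all
qed

lemma ex_test_channel:
  assumes \<sigma>: "\<sigma> > 0" and R: "R \<ge> 0"
  shows "\<exists>p \<nu>. symmetric_backward_channel \<mu> \<sigma> (\<sigma> * 2 powr (- R)) p \<nu>"
proof (cases "R = 0")
  case True
  then show ?thesis using constant_test_channel[OF \<sigma>] by auto
next
  case False
  \<comment> \<open>Chosen so that s^2 + \<tau>^2 = \<sigma>^2; s^2 is the variance of Y, and it is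
    positive because R > 0.\<close>
  define s where "s = \<sigma> * sqrt (1 - 2 powr (- 2 * R))"
  have lt: "2 powr (- 2 * R) < (1 :: real)"
    using powr_less_mono[of "- 2 * R" 0 "2 :: real"] False R by simp
  have "(\<sigma> * 2 powr (- R))\<^sup>2 = \<sigma>\<^sup>2 * 2 powr (- 2 * R)"
    by (simp add: power_mult_distrib power2_eq_square powr_add[symmetric])
  moreover have "s\<^sup>2 = \<sigma>\<^sup>2 * (1 - 2 powr (- 2 * R))"
    using lt by (simp add: s_def power_mult_distrib)
  ultimately have "\<sigma>\<^sup>2 = s\<^sup>2 + (\<sigma> * 2 powr (- R))\<^sup>2"
    by (simp only: algebra_simps)
  moreover have "s > 0" using lt \<sigma> by (simp add: s_def)
  ultimately show ?thesis
    using gaussian_test_channel[of s "\<sigma> * 2 powr (- R)" \<sigma> \<mu>] \<sigma> by auto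
qed

theorem mainTheorem2:
  fixes \<mu>0 \<sigma>0 R Rs :: real
  assumes "\<sigma>0 > 0" and "R \<ge> 0" and "Rs \<ge> 1"
    and characterization:
      "\<And>v. is_secrecy_rate_payoff \<mu>0 \<sigma>0 R Rs v \<longleftrightarrow> is_single_letter_max \<mu>0 \<sigma>0 R Rs v"
  shows "is_secrecy_rate_payoff \<mu>0 \<sigma>0 R Rs (1 - 2 powr (- 2 * R))"
proof -
  define \<tau> where "\<tau> = \<sigma>0 * 2 powr (- R)"
  obtain p \<nu> where "symmetric_backward_channel \<mu>0 \<sigma>0 \<tau> p \<nu>"
    using ex_test_channel[OF assms(1,2)] unfolding \<tau>_def by blast
  then interpret symmetric_backward_channel \<mu>0 \<sigma>0 \<tau> p \<nu> .
  \<comment> \<open>For this \<tau> the channel spends the communication rate R exactly.\<close>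
  have "\<sigma>0 / \<tau> = 2 powr R"
    using assms(1) by (simp add: \<tau>_def powr_minus field_simps)
  then have "log 2 (\<sigma>0 / \<tau>) \<le> R" by simp
  then have p: "p \<in> admissible \<mu>0 \<sigma>0 R Rs"
    by (rule channel_admissible) fact
  have "\<tau>\<^sup>2 = \<sigma>0\<^sup>2 * 2 powr (- 2 * R)"
    by (simp add: \<tau>_def power_mult_distrib power2_eq_square powr_add[symmetric])
  then have "1 - \<tau>\<^sup>2 / \<sigma>0\<^sup>2 = 1 - 2 powr (- 2 * R)"
    using assms(1) by simp
  then have "single_letter_value \<mu>0 \<sigma>0 p = ereal (1 - 2 powr (- 2 * R))"
    using single_letter_value_ge single_letter_value_le[OF assms(1,2) p] by (intro antisym) simp_all
  then show ?thesis
    unfolding characterization is_single_letter_max_def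
    using p single_letter_value_le[OF assms(1,2)] by blast
qed

end
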